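(* Let $\mathcal V$ be a congruence modular variety, $\mathbb A\in\mathcal V$, $n\ge 2$ and $\theta_0,\dots,\theta_{n-1}\in\mathrm{Con}(\mathbb A)$. Then $$[\theta_0,\dots,\theta_{n-1}]_{TC}=[\theta_0,\dots,\theta_{n-1}]_{H}.$$
   Context: Cube notation. Each $n\in\mathbb N$ is identified with $\{0,\dots,n-1\}$ and $2=\{0,1\}$. For a finite $S\subseteq\mathbb N$, $2^S$ is the set of functions $S\to 2$; $\mathbf 0,\mathbf 1\in 2^S$ are the constant functions. For a set $A$, an element $\gamma=(\gamma_f)_{f\in 2^S}\in A^{2^S}$ is an $(S)$-cube (an $(n)$-cube if $S=n$). For $i\in S$, $j\in 2$, the face $\mathrm{face}_i^j(\gamma)\in A^{2^{S\setminus\{i\}}}$ is $g\mapsto \gamma_{g\cup\{(i,j)\}}$. For $i\in S$ and $\zeta,\eta\in A^{2^{S\setminus\{i\}}}$, $\mathrm{glue}_{\{i\}}(\zeta,\eta)$ is the unique $\gamma$ with $\mathrm{face}_i^0(\gamma)=\zeta$, $\mathrm{face}_i^1(\gamma)=\eta$. For $R\subseteq A^{2^S}$, $\mathrm{face}_i(R)=\{(\mathrm{face}_i^0(\gamma),\mathrm{face}_i^1(\gamma)):\gamma\in R\}$. Further $\mathrm{refl}_i^j(\gamma)=\mathrm{glue}_{\{i\}}(\mathrm{face}_i^j\gamma,\mathrm{face}_i^j\gamma)$ and $\mathrm{sym}_i(\gamma)=\mathrm{glue}_{\{i\}}(\mathrm{face}_i^1\gamma,\mathrm{face}_i^0\gamma)$.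 For $x,y\in A$, $i\in S$, $\mathrm{cube}_i(x,y)\in A^{2^S}$ takes value $x$ at all $f$ with $f(i)=0$ and $y$ at all $f$ with $f(i)=1$. Lines. For $\gamma\in A^{2^S}$, $i\in S$, $f\in 2^{S\setminus\{i\}}$, the $(i)$-cross-section line of $\gamma$ at $f$ is the pair $(\gamma_{f\cup\{(i,0)\}},\gamma_{f\cup\{(i,1)\}})$; for $f=\mathbf 1$ it is the $(i)$-pivot line, and for $f\neq\mathbf 1$ it is an $(i)$-supporting line. For a congruence $\delta$, a $\delta$-pair is a pair in $\delta$. Higher dimensional relations. Let $\mathbb A$ be an algebra and $|S|=n\ge1$. A subuniverse $R$ of $\mathbb A^{2^S}$ is an $(n)$-dimensional tolerance of $\mathbb A$ if $\mathrm{refl}_i^j(\gamma),\mathrm{sym}_i(\gamma)\in R$ for all $\gamma\in R$, $i\in S$, $j\in 2$; it is an $(n)$-dimensional congruence if moreover $\mathrm{face}_i(R)$ is transitive for every $i\in S$. Centrality. For $\delta\in\mathrm{Con}(\mathbb A)$ and $i\in S$, $R\subseteq A^{2^S}$ has $(\delta,i)$-centrality if for every $\gamma\in R$ all of whose $(i)$-supporting lines are $\delta$-pairs, the $(i)$-pivot line of $\gamma$ is a $\delta$-pair; $R$ has $\delta$-centrality if it has $(\delta,i)$-centrality for all $i\in S$. Commutators. For $\theta_k\in\mathrm{Con}(\mathbb A)$ ($k\in S$), $M(\{\theta_k\}_{k\in S})$ is the subuniverse of $\mathbb A^{2^S}$ generated by all $\mathrm{cube}_k(x,y)$ with $k\in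 S$, $(x,y)\in\theta_k$, and $\Delta(\{\theta_k\}_{k\in S})$ is the smallest $(|S|)$-dimensional congruence of $\mathbb A$ containing $M(\{\theta_k\}_{k\in S})$; for $S=n$ write $M(\theta_0,\dots,\theta_{n-1})$, $\Delta(\theta_0,\dots,\theta_{n-1})$. For $n\ge2$, the term condition commutator $[\theta_0,\dots,\theta_{n-1}]_{TC}$ is the least $\delta\in\mathrm{Con}(\mathbb A)$ such that $M(\theta_0,\dots,\theta_{n-1})$ has $\delta$-centrality, and the hypercommutator $[\theta_0,\dots,\theta_{n-1}]_{H}$ is the least $\delta\in\mathrm{Con}(\mathbb A)$ such that $\Delta(\theta_0,\dots,\theta_{n-1})$ has $\delta$-centrality. *)

theory Defs
  imports "HOL-Library.FuncSet"
begin

definition algebra :: "('f \<Rightarrow> nat) \<Rightarrow> 'a set \<Rightarrow> ('f \<Rightarrow> 'a list \<Rightarrow> 'a) \<Rightarrow> bool" where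
  "algebra ar A F \<longleftrightarrow> A \<noteq> {} \<and>
     (\<forall>f xs. length xs = ar f \<and> set xs \<subseteq> A \<longrightarrow> F f xs \<in> A)"

datatype ('f, 'v) trm = Var 'v | Fn 'f "('f, 'v) trm list"

fun wf_trm :: "('f \<Rightarrow> nat) \<Rightarrow> ('f, 'v) trm \<Rightarrow> bool" where
  "wf_trm ar (Var v) = True"
| "wf_trm ar (Fn f ts) = (length ts = ar f \<and> (\<forall>t\<in>set ts. wf_trm ar t))"

fun eval_trm :: "('f \<Rightarrow> 'a list \<Rightarrow> 'a) \<Rightarrow> ('v \<Rightarrow> 'a) \<Rightarrow> ('f, 'v) trm \<Rightarrow> 'a" where
  "eval_trm F env (Var v) = env v"
| "eval_trm F env (Fn f ts) = F f (map (eval_trm F env) ts)"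

definition satisfies_id ::
  "'a set \<Rightarrow> ('f \<Rightarrow> 'a list \<Rightarrow> 'a) \<Rightarrow> ('f, nat) trm \<Rightarrow> ('f, nat) trm \<Rightarrow> bool" where
  "satisfies_id A F s t \<longleftrightarrow>
     (\<forall>env. (\<forall>v. env v \<in> A) \<longrightarrow> eval_trm F env s = eval_trm F env t)"

definition identities ::
  "('f \<Rightarrow> nat) \<Rightarrow> 'a set \<Rightarrow> ('f \<Rightarrow> 'a list \<Rightarrow> 'a) \<Rightarrow> (('f, nat) trm \<times> ('f, nat) trm) set" where
  "identities ar A F = {(s, t). wf_trm ar s \<and> wf_trm ar t \<and> satisfies_id A F s t}"

text \<open>B belongs to the variety V(A) = HSP(A) generated by A (Birkhoff: the class of
 algebras satisfying all identities of A).\<close>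
definition in_variety_of ::
  "('f \<Rightarrow> nat) \<Rightarrow> 'a set \<Rightarrow> ('f \<Rightarrow> 'a list \<Rightarrow> 'a) \<Rightarrow> 'b set \<Rightarrow> ('f \<Rightarrow> 'b list \<Rightarrow> 'b) \<Rightarrow> bool" where
  "in_variety_of ar A F B G \<longleftrightarrow> algebra ar B G \<and>
     (\<forall>(s, t) \<in> identities ar A F. satisfies_id B G s t)"

definition compatible :: "('f \<Rightarrow> nat) \<Rightarrow> 'a set \<Rightarrow> ('f \<Rightarrow> 'a list \<Rightarrow> 'a) \<Rightarrow> 'a rel \<Rightarrow> bool" where
  "compatible ar A F \<theta> \<longleftrightarrow>
     (\<forall>f xs ys. length xs = ar f \<and> length ys = ar f \<and> set xs \<subseteq> A \<and> set ys \<subseteq> A \<and>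
        list_all2 (\<lambda>x y. (x, y) \<in> \<theta>) xs ys \<longrightarrow> (F f xs, F f ys) \<in> \<theta>)"

definition Con :: "('f \<Rightarrow> nat) \<Rightarrow> 'a set \<Rightarrow> ('f \<Rightarrow> 'a list \<Rightarrow> 'a) \<Rightarrow> 'a rel set" where
  "Con ar A F = {\<theta>. equiv A \<theta> \<and> compatible ar A F \<theta>}"

definition con_join ::
  "('f \<Rightarrow> nat) \<Rightarrow> 'a set \<Rightarrow> ('f \<Rightarrow> 'a list \<Rightarrow> 'a) \<Rightarrow> 'a rel \<Rightarrow> 'a rel \<Rightarrow> 'a rel" where
  "con_join ar A F \<alpha> \<beta> = \<Inter>{\<theta> \<in> Con ar A F. \<alpha> \<union> \<beta> \<subseteq> \<theta>}"

definition con_modular :: "('f \<Rightarrow> nat) \<Rightarrow> 'a set \<Rightarrow> ('f \<Rightarrow> 'a list \<Rightarrow> 'a) \<Rightarrow> bool" where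
  "con_modular ar A F \<longleftrightarrow>
     (\<forall>\<alpha>\<in>Con ar A F. \<forall>\<beta>\<in>Con ar A F. \<forall>\<gamma>\<in>Con ar A F. \<alpha> \<subseteq> \<gamma> \<longrightarrow>
        con_join ar A F \<alpha> \<beta> \<inter> \<gamma> = con_join ar A F \<alpha> (\<beta> \<inter> \<gamma>))"

text \<open>A lies in a congruence modular variety iff the variety V(A) generated by A
 is congruence modular.  Since HOL cannot quantify over types inside a formula,
 we quantify over all algebras in V(A) whose carrier lies in the type
 ('a + 'f) list, which has cardinality max(|A|,|signature|,aleph0); by the
 downward Loewenheim-Skolem theorem any failure of congruence modularity in V(A)
 is witnessed by an algebra of that size, so this is equivalent.\<close>
definition in_CM_variety :: "('f \<Rightarrow> nat) \<Rightarrow> 'a set \<Rightarrow> ('f \<Rightarrow> 'a list \<Rightarrow> 'a) \<Rightarrow> bool" where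
  "in_CM_variety ar A F \<longleftrightarrow>
     (\<forall>(B :: ('a + 'f) list set) G. in_variety_of ar A F B G \<longrightarrow> con_modular ar B G)"

text \<open>An element f of 2^S is represented by the subset {i \<in> S. f i = 1};
 an (S)-cube over A is an extensional function on Pow S with values in A.\<close>

definition cubes :: "nat set \<Rightarrow> 'a set \<Rightarrow> (nat set \<Rightarrow> 'a) set" where
  "cubes S A = (Pow S \<rightarrow>\<^sub>E A)"

definition face :: "nat set \<Rightarrow> nat \<Rightarrow> bool \<Rightarrow> (nat set \<Rightarrow> 'a) \<Rightarrow> (nat set \<Rightarrow> 'a)" where
  "face S i j \<gamma> = (\<lambda>u\<in>Pow (S - {i}). \<gamma> (if j then insert i u else u))"

definition glue :: "nat set \<Rightarrow> nat \<Rightarrow> (nat set \<Rightarrow> 'a) \<Rightarrow> (nat set \<Rightarrow> 'a) \<Rightarrow> (nat set \<Rightarrow> 'a)" where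
  "glue S i \<zeta> \<eta> = (\<lambda>u\<in>Pow S. if i \<in> u then \<eta> (u - {i}) else \<zeta> u)"

definition refl_cube :: "nat set \<Rightarrow> nat \<Rightarrow> bool \<Rightarrow> (nat set \<Rightarrow> 'a) \<Rightarrow> (nat set \<Rightarrow> 'a)" where
  "refl_cube S i j \<gamma> = glue S i (face S i j \<gamma>) (face S i j \<gamma>)"

definition sym_cube :: "nat set \<Rightarrow> nat \<Rightarrow> (nat set \<Rightarrow> 'a) \<Rightarrow> (nat set \<Rightarrow> 'a)" where
  "sym_cube S i \<gamma> = glue S i (face S i True \<gamma>) (face S i False \<gamma>)"

definition face_rel :: "nat set \<Rightarrow> nat \<Rightarrow> (nat set \<Rightarrow> 'a) set \<Rightarrow> ((nat set \<Rightarrow> 'a) \<times> (nat set \<Rightarrow> 'a)) set" where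
  "face_rel S i R = {(face S i False \<gamma>, face S i True \<gamma>) | \<gamma>. \<gamma> \<in> R}"

definition cube_k :: "nat set \<Rightarrow> nat \<Rightarrow> 'a \<Rightarrow> 'a \<Rightarrow> (nat set \<Rightarrow> 'a)" where
  "cube_k S k x y = (\<lambda>u\<in>Pow S. if k \<in> u then y else x)"

definition cube_subuniverse ::
  "('f \<Rightarrow> nat) \<Rightarrow> 'a set \<Rightarrow> ('f \<Rightarrow> 'a list \<Rightarrow> 'a) \<Rightarrow> nat set \<Rightarrow> (nat set \<Rightarrow> 'a) set \<Rightarrow> bool" where
  "cube_subuniverse ar A F S R \<longleftrightarrow> R \<subseteq> cubes S A \<and>
     (\<forall>f \<gamma>s. length \<gamma>s = ar f \<and> set \<gamma>s \<subseteq> R \<longrightarrow>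
        (\<lambda>u\<in>Pow S. F f (map (\<lambda>\<gamma>. \<gamma> u) \<gamma>s)) \<in> R)"

definition hd_tolerance ::
  "('f \<Rightarrow> nat) \<Rightarrow> 'a set \<Rightarrow> ('f \<Rightarrow> 'a list \<Rightarrow> 'a) \<Rightarrow> nat set \<Rightarrow> (nat set \<Rightarrow> 'a) set \<Rightarrow> bool" where
  "hd_tolerance ar A F S R \<longleftrightarrow> cube_subuniverse ar A F S R \<and>
     (\<forall>\<gamma>\<in>R. \<forall>i\<in>S. (\<forall>j. refl_cube S i j \<gamma> \<in> R) \<and> sym_cube S i \<gamma> \<in> R)"

definition hd_congruence ::
  "('f \<Rightarrow> nat) \<Rightarrow> 'a set \<Rightarrow> ('f \<Rightarrow> 'a list \<Rightarrow> 'a) \<Rightarrow> nat set \<Rightarrow> (nat set \<Rightarrow> 'a) set \<Rightarrow> bool" where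
  "hd_congruence ar A F S R \<longleftrightarrow> hd_tolerance ar A F S R \<and>
     (\<forall>i\<in>S. trans (face_rel S i R))"

definition M_rel ::
  "('f \<Rightarrow> nat) \<Rightarrow> 'a set \<Rightarrow> ('f \<Rightarrow> 'a list \<Rightarrow> 'a) \<Rightarrow> nat set \<Rightarrow> (nat \<Rightarrow> 'a rel) \<Rightarrow> (nat set \<Rightarrow> 'a) set" where
  "M_rel ar A F S \<theta> = \<Inter>{R. cube_subuniverse ar A F S R \<and>
      (\<forall>k\<in>S. \<forall>(x, y)\<in>\<theta> k. cube_k S k x y \<in> R)}"

definition Delta_rel ::
  "('f \<Rightarrow> nat) \<Rightarrow> 'a set \<Rightarrow> ('f \<Rightarrow> 'a list \<Rightarrow> 'a) \<Rightarrow> nat set \<Rightarrow> (nat \<Rightarrow> 'a rel) \<Rightarrow> (nat set \<Rightarrow> 'a) set" where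
  "Delta_rel ar A F S \<theta> = \<Inter>{R. hd_congruence ar A F S R \<and> M_rel ar A F S \<theta> \<subseteq> R}"

text \<open>(delta,i)-centrality: supporting lines are cross-section lines at u \<noteq> S-{i}
 (u \<subseteq> S-{i} encodes f); the pivot line is the one at u = S-{i} (f = 1).\<close>
definition central_at :: "nat set \<Rightarrow> 'a rel \<Rightarrow> nat \<Rightarrow> (nat set \<Rightarrow> 'a) set \<Rightarrow> bool" where
  "central_at S \<delta> i R \<longleftrightarrow>
     (\<forall>\<gamma>\<in>R. (\<forall>u. u \<subseteq> S - {i} \<and> u \<noteq> S - {i} \<longrightarrow> (\<gamma> u, \<gamma> (insert i u)) \<in> \<delta>)
        \<longrightarrow> (\<gamma> (S - {i}), \<gamma> S) \<in> \<delta>)"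

definition central :: "nat set \<Rightarrow> 'a rel \<Rightarrow> (nat set \<Rightarrow> 'a) set \<Rightarrow> bool" where
  "central S \<delta> R \<longleftrightarrow> (\<forall>i\<in>S. central_at S \<delta> i R)"

text \<open>Least congruence with the centrality property (centrality is preserved
 under intersections, and A x A always has it, so the intersection is the least one).\<close>
definition TC_comm ::
  "('f \<Rightarrow> nat) \<Rightarrow> 'a set \<Rightarrow> ('f \<Rightarrow> 'a list \<Rightarrow> 'a) \<Rightarrow> nat \<Rightarrow> (nat \<Rightarrow> 'a rel) \<Rightarrow> 'a rel" where
  "TC_comm ar A F n \<theta> =
     \<Inter>{\<delta> \<in> Con ar A F. central {..<n} \<delta> (M_rel ar A F {..<n} \<theta>)}"

definition H_comm ::
  "('f \<Rightarrow> nat) \<Rightarrow> 'a set \<Rightarrow> ('f \<Rightarrow> 'a list \<Rightarrow> 'a) \<Rightarrow> nat \<Rightarrow> (nat \<Rightarrow> 'a rel) \<Rightarrow> 'a rel" where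
  "H_comm ar A F n \<theta> =
     \<Inter>{\<delta> \<in> Con ar A F. central {..<n} \<delta> (Delta_rel ar A F {..<n} \<theta>)}"

end

theory Submission
  imports Defs
begin

text \<open>
  Fix a congruence \<open>\<delta>\<close>; the point is that \<open>\<delta>\<close>-centrality passes from \<open>M\<close> to \<open>\<Delta>\<close>.  Modularity
  of a free algebra yields terms \<open>t\<close> with \<open>t(x, y, y, x) = x\<close> (Day terms) that detect \<open>\<delta>\<close>: if
  \<open>(b, d) \<in> \<delta>\<close> and \<open>t(a, b, d, c)\<close>, \<open>t(a, a, c, c)\<close> are \<open>\<delta>\<close>-related for all of them, then
  \<open>(a, c) \<in> \<delta>\<close>.  Applied to a cube and its degeneracies, a Day term moves a question about lines
  in direction \<open>i\<close> to one about lines in direction \<open>j\<close>.  Hence for a higher dimensional tolerance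
  centrality in one direction implies centrality in all, and centrality survives composing cubes
  in a direction \<open>k\<close>, because the question can be moved through all directions other than \<open>k\<close>
  until only the pivot lines of the two composed cubes are in doubt.  A maximal \<open>\<delta>\<close>-central
  tolerance above \<open>M\<close> is therefore closed under composition, i.e. a higher dimensional congruence,
  and contains \<open>\<Delta>\<close>.
\<close>

section \<open>Congruences and term operations\<close>

lemma Con_subset: "\<theta> \<in> Con ar A F \<Longrightarrow> \<theta> \<subseteq> A \<times> A"
  and Con_refl: "\<theta> \<in> Con ar A F \<Longrightarrow> x \<in> A \<Longrightarrow> (x, x) \<in> \<theta>"
  and Con_sym: "\<theta> \<in> Con ar A F \<Longrightarrow> (x, y) \<in> \<theta> \<Longrightarrow> (y, x) \<in> \<theta>"
  and Con_trans: "\<theta> \<in> Con ar A F \<Longrightarrow> (x, y) \<in> \<theta> \<Longrightarrow> (y, z) \<in> \<theta> \<Longrightarrow> (x, z) \<in> \<theta>"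
  unfolding Con_def equiv_def refl_on_def sym_def trans_def by blast+

lemma Con_compatible:
  assumes "\<theta> \<in> Con ar A F" "length xs = ar f" "list_all2 (\<lambda>x y. (x, y) \<in> \<theta>) xs ys"
  shows "(F f xs, F f ys) \<in> \<theta>"
proof -
  have "set xs \<subseteq> A" "set ys \<subseteq> A"
    using assms(3) Con_subset[OF assms(1)]
    by (auto simp: list_all2_conv_all_nth in_set_conv_nth) blast+
  with assms show ?thesis
    unfolding Con_def compatible_def using list_all2_lengthD[OF assms(3)] by simp
qed

lemma eval_trm_closed:
  assumes "algebra ar A F" "wf_trm ar t" "\<And>v. e v \<in> A"
  shows "eval_trm F e t \<in> A"
  using assms(2)
proof (induction t)
  case (Fn f ts)
  then have "set (map (eval_trm F e) ts) \<subseteq> A" by auto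
  with Fn.prems assms(1) show ?case by (simp add: algebra_def)
qed (simp add: assms(3))

lemma eval_trm_Con:
  assumes "\<theta> \<in> Con ar A F" "wf_trm ar t" "\<And>v. (e v, e' v) \<in> \<theta>"
  shows "(eval_trm F e t, eval_trm F e' t) \<in> \<theta>"
  using assms(2)
proof (induction t)
  case (Fn f ts)
  then have "list_all2 (\<lambda>x y. (x, y) \<in> \<theta>) (map (eval_trm F e) ts) (map (eval_trm F e') ts)"
    by (auto simp: list_all2_conv_all_nth)
  with Fn.prems show ?case by (simp add: Con_compatible[OF assms(1)])
qed (simp add: assms(3))

subsection \<open>Joins of congruences\<close>

text \<open>Arguments are exchanged one at a time from left to right, each along its own path;
  \<open>pre\<close> collects those already exchanged.\<close>

lemma rtrancl_union_compatible:
  assumes \<alpha>: "\<alpha> \<in> Con ar A F" and \<beta>: "\<beta> \<in> Con ar A F"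
    and xy: "list_all2 (\<lambda>x y. (x, y) \<in> (\<alpha> \<union> \<beta>)\<^sup>*) xs ys"
    and "set (pre @ xs) \<subseteq> A" "length (pre @ xs) = ar f"
  shows "(F f (pre @ xs), F f (pre @ ys)) \<in> (\<alpha> \<union> \<beta>)\<^sup>*"
  using xy assms(4,5)
proof (induction arbitrary: pre rule: list_all2_induct)
  case (Cons x xs y ys)
  have "y \<in> A \<and> (F f (pre @ x # xs), F f (pre @ y # xs)) \<in> (\<alpha> \<union> \<beta>)\<^sup>*"
    using Cons.hyps(1)
  proof (induction rule: rtrancl_induct)
    case (step y z)
    have one: "(F f (pre @ y # xs), F f (pre @ z # xs)) \<in> \<kappa>"
      if "\<kappa> \<in> Con ar A F" "(y, z) \<in> \<kappa>" for \<kappa>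
      using Cons.prems that
      by (intro Con_compatible[OF that(1)] list_all2_appendI list.rel_intros)
        (auto intro!: list.rel_refl_strong Con_refl[OF that(1)])
    have "z \<in> A" using step Con_subset[OF \<alpha>] Con_subset[OF \<beta>] by blast
    then show ?case using step one[OF \<alpha>] one[OF \<beta>] by (meson Un_iff rtrancl.rtrancl_into_rtrancl)
  qed (use Cons.prems in auto)
  moreover from this have "(F f ((pre @ [y]) @ xs), F f ((pre @ [y]) @ ys)) \<in> (\<alpha> \<union> \<beta>)\<^sup>*"
    using Cons.prems by (intro Cons.IH) auto
  ultimately show ?case by (auto intro: rtrancl_trans)
qed simp

text \<open>The path relation, cut down to the carrier because the closure is reflexive on the whole
  type, is itself a congruence above both.\<close>

lemma con_join_subset_rtrancl:
  assumes alg: "algebra ar A F" and \<alpha>: "\<alpha> \<in> Con ar A F" and \<beta>: "\<beta> \<in> Con ar A F"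
  shows "con_join ar A F \<alpha> \<beta> \<subseteq> (\<alpha> \<union> \<beta>)\<^sup>*"
proof -
  let ?J = "(\<alpha> \<union> \<beta>)\<^sup>* \<inter> A \<times> A"
  have "sym (\<alpha> \<union> \<beta>)" using Con_sym[OF \<alpha>] Con_sym[OF \<beta>] by (auto simp: sym_def)
  then have "sym ((\<alpha> \<union> \<beta>)\<^sup>*)" by (rule sym_rtrancl)
  then have "equiv A ?J"
    unfolding equiv_def refl_on_def sym_def trans_def by (auto intro: rtrancl_trans)
  moreover have "compatible ar A F ?J"
    unfolding compatible_def
  proof (intro allI impI)
    fix f xs ys
    assume h: "length xs = ar f \<and> length ys = ar f \<and> set xs \<subseteq> A \<and> set ys \<subseteq> A \<and>
      list_all2 (\<lambda>x y. (x, y) \<in> ?J) xs ys"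
    then have "list_all2 (\<lambda>x y. (x, y) \<in> (\<alpha> \<union> \<beta>)\<^sup>*) xs ys" by (auto elim: list_all2_mono)
    then have "(F f xs, F f ys) \<in> (\<alpha> \<union> \<beta>)\<^sup>*"
      using rtrancl_union_compatible[OF \<alpha> \<beta>, of xs ys "[]" f] h by simp
    then show "(F f xs, F f ys) \<in> ?J" using h alg by (simp add: algebra_def)
  qed
  ultimately have "?J \<in> Con ar A F" by (simp add: Con_def)
  moreover have "\<alpha> \<union> \<beta> \<subseteq> ?J" using Con_subset[OF \<alpha>] Con_subset[OF \<beta>] by blast
  ultimately show ?thesis unfolding con_join_def by blast
qed

subsection \<open>A free algebra carried by words\<close>

text \<open>Words are read as reverse Polish programs: a block of \<open>i + 1\<close> letters \<open>Inl _\<close> closed by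
  any \<open>Inr _\<close> pushes \<open>Var i\<close>, and an \<open>Inr f\<close> outside such a block applies \<open>f\<close> to the top of the
  stack.\<close>
fun rpn_step :: "('f \<Rightarrow> nat) \<Rightarrow> 'a + 'f \<Rightarrow> nat \<times> ('f, nat) trm list \<Rightarrow> nat \<times> ('f, nat) trm list"
  where
  "rpn_step ar (Inl a) (c, st) = (Suc c, st)"
| "rpn_step ar (Inr f) (0, st) = (0, Fn f (rev (take (ar f) st)) # drop (ar f) st)"
| "rpn_step ar (Inr f) (Suc c, st) = (0, Var c # st)"

text \<open>Words that are not programs decode to arbitrary, possibly ill-formed terms;
  \<open>free_rep\<close> therefore asks for well-formedness.\<close>

definition decode :: "('f \<Rightarrow> nat) \<Rightarrow> ('a + 'f) list \<Rightarrow> ('f, nat) trm" where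
  "decode ar l = hd (snd (fold (rpn_step ar) l (0, [])))"

lemma fold_rpn_step_Inl:
  "fold (rpn_step ar) (replicate i (Inl a)) (c, st) = (c + i, st)"
  by (induction i arbitrary: c) auto

text \<open>The stack below is left arbitrary so that programs compose by concatenation.\<close>

lemma rpn_program_exists:
  fixes t :: "('f, nat) trm"
  assumes "wf_trm ar t"
  shows "\<exists>l :: ('a + 'f) list. \<forall>st. fold (rpn_step ar) l (0, st) = (0, t # st)"
  using assms
proof (induction t)
  case (Var i)
  \<comment> \<open>\<open>Var i\<close> takes \<open>i + 1\<close> letters, so that counter 0 is
    free to mean that the next \<open>Inr\<close> is an operation symbol.\<close>
  show ?case
    by (rule exI[of _ "replicate (Suc i) (Inl undefined) @ [Inr undefined]"])
      (simp add: fold_rpn_step_Inl del: replicate_Suc fold_replicate)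
next
  case (Fn f ts)
  have "\<exists>l :: ('a + 'f) list. \<forall>st. fold (rpn_step ar) l (0, st) = (0, rev us @ st)"
    if "set us \<subseteq> set ts" for us
    using that
  proof (induction us rule: rev_induct)
    case Nil
    show ?case by (rule exI[of _ "[]"]) simp
  next
    case (snoc u us)
    then obtain l1 l2 :: "('a + 'f) list"
      where "\<forall>st. fold (rpn_step ar) l1 (0, st) = (0, rev us @ st)"
        and "\<forall>st. fold (rpn_step ar) l2 (0, st) = (0, u # st)"
      using Fn by (auto, blast)
    then show ?case by (intro exI[of _ "l1 @ l2"]) simp
  qed
  then obtain l :: "('a + 'f) list"
    where "\<forall>st. fold (rpn_step ar) l (0, st) = (0, rev ts @ st)" by blast
  then show ?case using Fn.prems by (intro exI[of _ "l @ [Inr f]"]) simp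
qed

lemma decode_surj: "wf_trm ar t \<Longrightarrow> \<exists>l :: ('a + 'f) list. decode ar l = t"
  for t :: "('f, nat) trm"
  using rpn_program_exists[of ar t] unfolding decode_def by (metis list.sel(1) snd_conv)

text \<open>\<open>in_CM_variety\<close> ranges only over algebras carried by words over
  \<open>'a + 'f\<close>. A class of terms modulo the identities of \<open>A\<close> is thus
  represented by one chosen word that decodes into it.\<close>

definition free_rep ::
  "('f \<Rightarrow> nat) \<Rightarrow> 'a set \<Rightarrow> ('f \<Rightarrow> 'a list \<Rightarrow> 'a) \<Rightarrow> ('f, nat) trm \<Rightarrow> ('a + 'f) list" where
  "free_rep ar A F t = (SOME l. wf_trm ar (decode ar l) \<and> satisfies_id A F (decode ar l) t)"

definition free_carrier ::
  "('f \<Rightarrow> nat) \<Rightarrow> 'a set \<Rightarrow> ('f \<Rightarrow> 'a list \<Rightarrow> 'a) \<Rightarrow> ('a + 'f) list set" where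
  "free_carrier ar A F = free_rep ar A F ` {t. wf_trm ar t}"

definition free_op ::
  "('f \<Rightarrow> nat) \<Rightarrow> 'a set \<Rightarrow> ('f \<Rightarrow> 'a list \<Rightarrow> 'a) \<Rightarrow> 'f \<Rightarrow> ('a + 'f) list list \<Rightarrow> ('a + 'f) list" where
  "free_op ar A F f ls = free_rep ar A F (Fn f (map (decode ar) ls))"

lemma decode_free_rep:
  fixes A :: "'a set" and t :: "('f, nat) trm"
  assumes "wf_trm ar t"
  shows "wf_trm ar (decode ar (free_rep ar A F t))"
    and "satisfies_id A F (decode ar (free_rep ar A F t)) t"
proof -
  obtain l :: "('a + 'f) list" where "decode ar l = t" using decode_surj[OF assms] by blast
  then have "wf_trm ar (decode ar l) \<and> satisfies_id A F (decode ar l) t"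
    using assms by (simp add: satisfies_id_def)
  from someI[of "\<lambda>l. wf_trm ar (decode ar l) \<and> satisfies_id A F (decode ar l) t", OF this]
  show "wf_trm ar (decode ar (free_rep ar A F t))"
    and "satisfies_id A F (decode ar (free_rep ar A F t)) t"
    by (simp_all add: free_rep_def)
qed

lemma free_rep_cong: "satisfies_id A F s t \<Longrightarrow> free_rep ar A F s = free_rep ar A F t"
  unfolding free_rep_def satisfies_id_def by (rule arg_cong[where f = Eps]) auto

lemma free_carrier_wf: "l \<in> free_carrier ar A F \<Longrightarrow> wf_trm ar (decode ar l)"
  by (auto simp: free_carrier_def decode_free_rep)

fun subst_trm :: "('v \<Rightarrow> ('f, 'w) trm) \<Rightarrow> ('f, 'v) trm \<Rightarrow> ('f, 'w) trm" where
  "subst_trm \<sigma> (Var v) = \<sigma> v"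
| "subst_trm \<sigma> (Fn f ts) = Fn f (map (subst_trm \<sigma>) ts)"

lemma eval_subst_trm: "eval_trm F e (subst_trm \<sigma> t) = eval_trm F (\<lambda>v. eval_trm F e (\<sigma> v)) t"
  by (induction t) (auto simp: comp_def cong: map_cong)

lemma wf_subst_trm: "wf_trm ar t \<Longrightarrow> (\<And>v. wf_trm ar (\<sigma> v)) \<Longrightarrow> wf_trm ar (subst_trm \<sigma> t)"
  by (induction t) auto

lemma free_algebra:
  fixes ar :: "'f \<Rightarrow> nat" and A :: "'a set"
  shows "algebra ar (free_carrier ar A F) (free_op ar A F)"
  unfolding algebra_def
proof (intro conjI allI impI)
  show "free_carrier ar A F \<noteq> {}"
    by (auto simp: free_carrier_def intro: exI[of _ "Var 0"])
next
  fix f and xs :: "('a + 'f) list list"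
  assume "length xs = ar f \<and> set xs \<subseteq> free_carrier ar A F"
  then show "free_op ar A F f xs \<in> free_carrier ar A F"
    unfolding free_op_def using free_carrier_wf
    by (subst free_carrier_def, intro imageI) (auto, blast)
qed

text \<open>A variable is sent to a word that is already a chosen representative, so choosing again
  fixes it; passing to representatives of subterms does not change the class of a term.\<close>

lemma eval_free_op:
  assumes "\<And>v. e v \<in> free_carrier ar A F" "wf_trm ar t"
  shows "eval_trm (free_op ar A F) e t = free_rep ar A F (subst_trm (\<lambda>v. decode ar (e v)) t)"
  using assms(2)
proof (induction t)
  case (Var v)
  obtain t where "wf_trm ar t" "e v = free_rep ar A F t"
    using assms(1)[of v] by (auto simp: free_carrier_def)
  then show ?case by (simp add: free_rep_cong[OF decode_free_rep(2)])
next
  case (Fn f ts)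
  let ?\<sigma> = "\<lambda>v. decode ar (e v)"
  have "satisfies_id A F (decode ar (free_rep ar A F (subst_trm ?\<sigma> t))) (subst_trm ?\<sigma> t)"
    if "t \<in> set ts" for t
    using that Fn.prems assms(1) by (intro decode_free_rep wf_subst_trm) (auto intro: free_carrier_wf)
  then have "satisfies_id A F (Fn f (map (\<lambda>t. decode ar (free_rep ar A F (subst_trm ?\<sigma> t))) ts))
      (Fn f (map (subst_trm ?\<sigma>) ts))"
    by (auto simp: satisfies_id_def intro!: arg_cong[where f = "F f"])
  from free_rep_cong[OF this] show ?case
    using Fn by (simp add: free_op_def comp_def cong: map_cong)
qed

text \<open>Evaluation in the free algebra is substitution, and the identities of \<open>A\<close>
  are stable under substituting well-formed terms.\<close>

lemma free_in_variety:
  fixes ar :: "'f \<Rightarrow> nat" and A :: "'a set"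
  assumes "algebra ar A F"
  shows "in_variety_of ar A F (free_carrier ar A F) (free_op ar A F)"
  unfolding in_variety_of_def
proof (intro conjI free_algebra ballI, clarify)
  fix s t :: "('f, nat) trm" assume "(s, t) \<in> identities ar A F"
  then have st: "wf_trm ar s" "wf_trm ar t" "satisfies_id A F s t" by (auto simp: identities_def)
  show "satisfies_id (free_carrier ar A F) (free_op ar A F) s t"
    unfolding satisfies_id_def
  proof (intro allI impI)
    fix e :: "nat \<Rightarrow> ('a + 'f) list" assume e: "\<forall>v. e v \<in> free_carrier ar A F"
    have "satisfies_id A F (subst_trm (\<lambda>v. decode ar (e v)) s) (subst_trm (\<lambda>v. decode ar (e v)) t)"
      unfolding satisfies_id_def
    proof (intro allI impI)
      fix e' :: "nat \<Rightarrow> 'a" assume "\<forall>v. e' v \<in> A"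
      then have "\<forall>v. eval_trm F e' (decode ar (e v)) \<in> A"
        using e by (auto intro: eval_trm_closed[OF assms] free_carrier_wf)
      then show "eval_trm F e' (subst_trm (\<lambda>v. decode ar (e v)) s) =
          eval_trm F e' (subst_trm (\<lambda>v. decode ar (e v)) t)"
        using st(3) by (simp add: eval_subst_trm satisfies_id_def)
    qed
    from free_rep_cong[OF this]
    show "eval_trm (free_op ar A F) e s = eval_trm (free_op ar A F) e t"
      using e st by (simp add: eval_free_op)
  qed
qed

text \<open>The common kernel of the homomorphisms from the free algebra to \<open>A\<close> that
  extend the assignments in \<open>E\<close>.\<close>

definition env_kernel ::
  "('f \<Rightarrow> nat) \<Rightarrow> 'a set \<Rightarrow> ('f \<Rightarrow> 'a list \<Rightarrow> 'a) \<Rightarrow> (nat \<Rightarrow> 'a) set \<Rightarrow> ('a + 'f) list rel" where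
  "env_kernel ar A F E = {(p, q). p \<in> free_carrier ar A F \<and> q \<in> free_carrier ar A F \<and>
     (\<forall>e\<in>E. eval_trm F e (decode ar p) = eval_trm F e (decode ar q))}"

lemma eval_decode_free_rep:
  "wf_trm ar t \<Longrightarrow> (\<And>v. e v \<in> A) \<Longrightarrow>
    eval_trm F e (decode ar (free_rep ar A F t)) = eval_trm F e t"
  using decode_free_rep(2)[of ar t A F] by (simp add: satisfies_id_def)

lemma env_kernel_Con:
  fixes ar :: "'f \<Rightarrow> nat" and A :: "'a set"
  assumes "\<And>e v. e \<in> E \<Longrightarrow> e v \<in> A"
  shows "env_kernel ar A F E \<in> Con ar (free_carrier ar A F) (free_op ar A F)"
proof -
  have "compatible ar (free_carrier ar A F) (free_op ar A F) (env_kernel ar A F E)"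
    unfolding compatible_def
  proof (intro allI impI)
    fix f and xs ys :: "('a + 'f) list list"
    assume h: "length xs = ar f \<and> length ys = ar f \<and> set xs \<subseteq> free_carrier ar A F \<and>
      set ys \<subseteq> free_carrier ar A F \<and> list_all2 (\<lambda>x y. (x, y) \<in> env_kernel ar A F E) xs ys"
    \<comment> \<open>Evaluation under \<open>e\<close> is a homomorphism from the free algebra to
      \<open>A\<close>.\<close>
    have ev: "eval_trm F e (decode ar (free_op ar A F f zs)) =
        F f (map (\<lambda>z. eval_trm F e (decode ar z)) zs)"
      if "e \<in> E" "set zs \<subseteq> free_carrier ar A F" "length zs = ar f" for e zs
      unfolding free_op_def
      using that assms by (subst eval_decode_free_rep) (auto simp: comp_def intro: free_carrier_wf)
    have "map (\<lambda>z. eval_trm F e (decode ar z)) xs = map (\<lambda>z. eval_trm F e (decode ar z)) ys"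
      if "e \<in> E" for e
      using h that by (auto simp: list_eq_iff_nth_eq list_all2_conv_all_nth env_kernel_def)
    then show "(free_op ar A F f xs, free_op ar A F f ys) \<in> env_kernel ar A F E"
      using h free_algebra[of ar A F] by (auto simp: env_kernel_def ev algebra_def)
  qed
  then show ?thesis
    by (auto simp: Con_def equiv_def refl_on_def sym_def trans_def env_kernel_def)
qed

subsection \<open>Day terms\<close>

text \<open>The fourth value also serves all later variables, which keeps the assignment inside
  \<open>A\<close>.\<close>

definition env4 :: "'a \<Rightarrow> 'a \<Rightarrow> 'a \<Rightarrow> 'a \<Rightarrow> nat \<Rightarrow> 'a" where
  "env4 x y z w v = (if v = 0 then x else if v = 1 then y else if v = 2 then z else w)"

lemma env4_closed: "x \<in> A \<Longrightarrow> y \<in> A \<Longrightarrow> z \<in> A \<Longrightarrow> w \<in> A \<Longrightarrow> env4 x y z w v \<in> A"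
  by (simp add: env4_def)

text \<open>Only the identity shared by all members of a Day sequence is recorded; the identities
  linking consecutive members stay inside the next proof.\<close>

definition day_terms ::
  "('f \<Rightarrow> nat) \<Rightarrow> 'a set \<Rightarrow> ('f \<Rightarrow> 'a list \<Rightarrow> 'a) \<Rightarrow> ('f, nat) trm set" where
  "day_terms ar A F =
     {t. wf_trm ar t \<and> (\<forall>x\<in>A. \<forall>y\<in>A. eval_trm F (env4 x y y x) t = x)}"

text \<open>In the free algebra, modularity links the generators \<open>x\<close> and \<open>u\<close> by a path of terms whose
  consecutive members agree at \<open>(x, x, u, u)\<close> or at \<open>(x, y, y, u)\<close>; these are Day's terms, and the
  claim travels along the path.\<close>
lemma day_terms_separate:
  assumes alg: "algebra ar A F" and cm: "in_CM_variety ar A F" and \<delta>: "\<delta> \<in> Con ar A F"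
    and A: "a \<in> A" "c \<in> A" and bd: "(b, d) \<in> \<delta>"
    and day: "\<And>t. t \<in> day_terms ar A F \<Longrightarrow>
      (eval_trm F (env4 a b d c) t, eval_trm F (env4 a a c c) t) \<in> \<delta>"
  shows "(a, c) \<in> \<delta>"
proof -
  let ?B = "free_carrier ar A F" and ?G = "free_op ar A F"
  \<comment> \<open>Day's configuration: \<alpha> links \<open>g 0\<close> to \<open>g 1\<close> and
    \<open>g 2\<close> to \<open>g 3\<close>, \<gamma> links \<open>g 1\<close> to
    \<open>g 2\<close>, \<beta> links \<open>g 0\<close> to \<open>g 3\<close>, and \<gamma> lies
    below \<beta>. The modular law then replaces \<alpha> by \<alpha> \<inter> \<beta> in the
    path.\<close>
  define \<alpha> where "\<alpha> = env_kernel ar A F {env4 x x u u | x u. x \<in> A \<and> u \<in> A}"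
  define \<beta> where "\<beta> = env_kernel ar A F {env4 x y y x | x y. x \<in> A \<and> y \<in> A}"
  define \<gamma> where "\<gamma> = env_kernel ar A F {env4 x y y u | x y u. x \<in> A \<and> y \<in> A \<and> u \<in> A}"
  define g where "g i = free_rep ar A F (Var i)" for i
  have con: "\<alpha> \<in> Con ar ?B ?G" "\<beta> \<in> Con ar ?B ?G" "\<gamma> \<in> Con ar ?B ?G"
    unfolding \<alpha>_def \<beta>_def \<gamma>_def by (auto intro!: env_kernel_Con env4_closed)
  have \<alpha>\<beta>: "\<alpha> \<inter> \<beta> \<in> Con ar ?B ?G"
  proof -
    let ?E = "{env4 x x u u | x u. x \<in> A \<and> u \<in> A} \<union> {env4 x y y x | x y. x \<in> A \<and> y \<in> A}"
    have "\<alpha> \<inter> \<beta> = env_kernel ar A F ?E"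
      unfolding \<alpha>_def \<beta>_def env_kernel_def ball_Un by blast
    then show ?thesis by (auto intro!: env_kernel_Con env4_closed)
  qed
  have \<gamma>\<beta>: "\<gamma> \<subseteq> \<beta>" by (auto simp: \<gamma>_def \<beta>_def env_kernel_def)
  have gB: "g i \<in> ?B" for i by (auto simp: g_def free_carrier_def)
  have evg: "eval_trm F e (decode ar (g i)) = e i" if "\<And>v. e v \<in> A" for e i
    using that by (simp add: g_def eval_decode_free_rep)
  have gens: "(g 0, g 1) \<in> \<alpha>" "(g 1, g 2) \<in> \<gamma>" "(g 2, g 3) \<in> \<alpha>" "(g 0, g 3) \<in> \<beta>"
    unfolding \<alpha>_def \<beta>_def \<gamma>_def env_kernel_def using gB
    by (auto simp: evg env4_closed) (auto simp: env4_def)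
  have "(g 0, g 3) \<in> con_join ar ?B ?G \<gamma> \<alpha>"
    unfolding con_join_def
  proof clarify
    fix \<kappa> assume \<kappa>: "\<kappa> \<in> Con ar ?B ?G" "\<gamma> \<union> \<alpha> \<subseteq> \<kappa>"
    then have "(g 0, g 1) \<in> \<kappa>" "(g 1, g 2) \<in> \<kappa>" "(g 2, g 3) \<in> \<kappa>" using gens by auto
    then show "(g 0, g 3) \<in> \<kappa>" using Con_trans[OF \<kappa>(1)] by metis
  qed
  moreover have "con_join ar ?B ?G \<gamma> \<alpha> \<inter> \<beta> = con_join ar ?B ?G \<gamma> (\<alpha> \<inter> \<beta>)"
    using cm free_in_variety[OF alg] con \<gamma>\<beta> unfolding in_CM_variety_def con_modular_def by blast
  ultimately have "(g 0, g 3) \<in> (\<gamma> \<union> \<alpha> \<inter> \<beta>)\<^sup>*"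
    using gens con_join_subset_rtrancl[OF free_algebra con(3) \<alpha>\<beta>] by blast
  \<comment> \<open>The invariant keeps every term on the path \<beta>-related to
    \<open>g 0\<close>, which makes it a Day term. A \<gamma>-step is taken after exchanging
    \<open>d\<close> for \<open>b\<close>, an \<alpha> \<inter> \<beta>-step after passing to
    \<open>(a, a, c, c)\<close> by \<open>day\<close>. At \<open>g 3\<close> the value is
    \<open>c\<close>.\<close>
  then have "(g 0, g 3) \<in> \<beta> \<and> (a, eval_trm F (env4 a b d c) (decode ar (g 3))) \<in> \<delta>"
  proof (induction rule: rtrancl_induct)
    case base
    have "b \<in> A" "d \<in> A" using bd Con_subset[OF \<delta>] by auto
    then show ?case using Con_refl[OF con(2) gB] Con_refl[OF \<delta>] A
      by (simp add: evg env4_closed) (simp add: env4_def)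
  next
    case (step l l')
    have bdA: "b \<in> A" "d \<in> A" using bd Con_subset[OF \<delta>] by auto
    have "(l, l') \<in> \<beta>" using step(2) \<gamma>\<beta> by blast
    then have l': "(g 0, l') \<in> \<beta>" using step.IH Con_trans[OF con(2)] by blast
    have via: "(p, q) \<in> \<delta>" if "(p, r) \<in> \<delta>" "(q, r) \<in> \<delta>" for p q r
      using Con_trans[OF \<delta> that(1)] Con_sym[OF \<delta> that(2)] .
    have day_l: "decode ar m \<in> day_terms ar A F" if "(g 0, m) \<in> \<beta>" for m
    proof -
      have "eval_trm F (env4 x y y x) (decode ar m) = x" if "x \<in> A" "y \<in> A" for x y
      proof -
        have "eval_trm F (env4 x y y x) (decode ar (g 0)) = eval_trm F (env4 x y y x) (decode ar m)"
          using \<open>(g 0, m) \<in> \<beta>\<close> that by (auto simp: \<beta>_def env_kernel_def)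
        then show ?thesis using that by (simp add: evg env4_closed) (simp add: env4_def)
      qed
      moreover have "m \<in> ?B" using that by (simp add: \<beta>_def env_kernel_def)
      ultimately show ?thesis by (simp add: day_terms_def free_carrier_wf)
    qed
    have "(eval_trm F (env4 a b d c) (decode ar l), eval_trm F (env4 a b d c) (decode ar l')) \<in> \<delta>"
      using step(2)
    proof
      assume ll: "(l, l') \<in> \<gamma>"
      then have "l \<in> ?B" "l' \<in> ?B" by (auto simp: \<gamma>_def env_kernel_def)
      then have *: "(eval_trm F (env4 a b d c) (decode ar m), eval_trm F (env4 a b b c) (decode ar m)) \<in> \<delta>"
        if "m \<in> {l, l'}" for m
        using that A bdA Con_sym[OF \<delta> bd]
        by (intro eval_trm_Con[OF \<delta>]) (auto simp: env4_def intro: free_carrier_wf Con_refl[OF \<delta>])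
      have "eval_trm F (env4 a b b c) (decode ar l) = eval_trm F (env4 a b b c) (decode ar l')"
        using ll A bdA by (auto simp: \<gamma>_def env_kernel_def)
      then show ?thesis using *[of l] *[of l'] by (auto intro: via)
    next
      assume "(l, l') \<in> \<alpha> \<inter> \<beta>"
      then have "eval_trm F (env4 a a c c) (decode ar l) = eval_trm F (env4 a a c c) (decode ar l')"
        using A by (auto simp: \<alpha>_def env_kernel_def)
      moreover have "(g 0, l) \<in> \<beta>" using step by simp
      ultimately show ?thesis using day[OF day_l] l' via by metis
    qed
    with step have "(a, eval_trm F (env4 a b d c) (decode ar l')) \<in> \<delta>"
      by (blast intro: Con_trans[OF \<delta>])
    with l' show ?case ..
  qed
  moreover have "eval_trm F (env4 a b d c) (decode ar (g 3)) = c"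
    using bd Con_subset[OF \<delta>] A by (subst evg) (auto intro: env4_closed simp: env4_def)
  ultimately show ?thesis by simp
qed

subsection \<open>Cubes\<close>

lemma refl_cube_False: "i \<in> S \<Longrightarrow> refl_cube S i False \<gamma> = (\<lambda>u\<in>Pow S. \<gamma> (u - {i}))"
  by (rule ext) (auto simp: refl_cube_def glue_def face_def)

lemma refl_cube_True: "i \<in> S \<Longrightarrow> refl_cube S i True \<gamma> = (\<lambda>u\<in>Pow S. \<gamma> (insert i u))"
  by (rule ext) (auto simp: refl_cube_def glue_def face_def)

lemma sym_cube_eq:
  "i \<in> S \<Longrightarrow> sym_cube S i \<gamma> = (\<lambda>u\<in>Pow S. \<gamma> (if i \<in> u then u - {i} else insert i u))"
  by (rule ext) (auto simp: sym_cube_def glue_def face_def)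

lemma cube_subuniverse_eval_trm:
  assumes R: "cube_subuniverse ar A F S R" and \<Gamma>: "\<And>v. \<Gamma> v \<in> R" and "wf_trm ar t"
  shows "(\<lambda>u\<in>Pow S. eval_trm F (\<lambda>v. \<Gamma> v u) t) \<in> R"
  using assms(3)
proof (induction t)
  case (Var v)
  have "\<Gamma> v \<in> Pow S \<rightarrow>\<^sub>E A" using R \<Gamma> by (auto simp: cube_subuniverse_def cubes_def)
  then have "(\<lambda>u\<in>Pow S. \<Gamma> v u) = \<Gamma> v" by (rule PiE_restrict)
  then show ?case using \<Gamma> by simp
next
  case (Fn f ts)
  let ?gs = "map (\<lambda>t. \<lambda>u\<in>Pow S. eval_trm F (\<lambda>v. \<Gamma> v u) t) ts"
  have "length ?gs = ar f" using Fn.prems by simp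
  moreover have "set ?gs \<subseteq> R" unfolding set_map by (intro image_subsetI Fn.IH) (use Fn.prems in auto)
  ultimately have "(\<lambda>u\<in>Pow S. F f (map (\<lambda>\<gamma>. \<gamma> u) ?gs)) \<in> R"
    using R unfolding cube_subuniverse_def by blast
  moreover have "(\<lambda>u\<in>Pow S. F f (map (\<lambda>\<gamma>. \<gamma> u) ?gs)) =
      (\<lambda>u\<in>Pow S. eval_trm F (\<lambda>v. \<Gamma> v u) (Fn f ts))"
    by (rule restrict_ext) (simp add: comp_def)
  ultimately show ?case by (simp only:)
qed

lemma cube_subuniverse_value:
  "cube_subuniverse ar A F S R \<Longrightarrow> \<gamma> \<in> R \<Longrightarrow> u \<subseteq> S \<Longrightarrow> \<gamma> u \<in> A"
  by (auto simp: cube_subuniverse_def cubes_def)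

lemma central_atD:
  "central_at S \<delta> i R \<Longrightarrow> \<gamma> \<in> R \<Longrightarrow>
    (\<And>u. u \<subseteq> S - {i} \<Longrightarrow> u \<noteq> S - {i} \<Longrightarrow> (\<gamma> u, \<gamma> (insert i u)) \<in> \<delta>) \<Longrightarrow>
    (\<gamma> (S - {i}), \<gamma> S) \<in> \<delta>"
  unfolding central_at_def by blast

text \<open>On the square \<open>b = \<gamma> w\<close>, \<open>a = \<gamma> (w \<union> {j})\<close>, \<open>d = \<gamma> (w \<union> {i})\<close>, \<open>c = \<gamma> (w \<union> {i, j})\<close> the new
  cube has the constant \<open>j\<close>-line \<open>(a, a)\<close> at \<open>w\<close> and the \<open>j\<close>-line
  \<open>(t(a, b, d, c), t(a, a, c, c))\<close> at \<open>w \<union> {i}\<close>.  It thus turns statements about \<open>i\<close>-lines into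
  statements about \<open>j\<close>-lines.\<close>
definition day_shift ::
  "('f \<Rightarrow> 'a list \<Rightarrow> 'a) \<Rightarrow> nat set \<Rightarrow> nat \<Rightarrow> nat \<Rightarrow> ('f, nat) trm \<Rightarrow> (nat set \<Rightarrow> 'a) \<Rightarrow> nat set \<Rightarrow> 'a"
  where
  "day_shift F S i j t \<gamma> = (\<lambda>u\<in>Pow S.
     eval_trm F (env4 (\<gamma> (insert j (u - {i}))) (\<gamma> (u - {i})) (\<gamma> u) (\<gamma> (insert j u))) t)"

lemma day_shift_closed:
  assumes R: "hd_tolerance ar A F S R" and \<gamma>: "\<gamma> \<in> R" and ij: "i \<in> S" "j \<in> S" "i \<noteq> j"
    and t: "t \<in> day_terms ar A F"
  shows "day_shift F S i j t \<gamma> \<in> R"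
proof -
  \<comment> \<open>The four arguments of \<open>t\<close> are \<gamma> and degeneracies of it, all
    of which belong to a tolerance.\<close>
  define \<Gamma> where "\<Gamma> = env4 (refl_cube S i False (refl_cube S j True \<gamma>))
    (refl_cube S i False \<gamma>) \<gamma> (refl_cube S j True \<gamma>)"
  have "\<Gamma> v \<in> R" for v
    using R \<gamma> ij by (auto simp: \<Gamma>_def hd_tolerance_def intro!: env4_closed)
  then have "(\<lambda>u\<in>Pow S. eval_trm F (\<lambda>v. \<Gamma> v u) t) \<in> R"
    using R t by (intro cube_subuniverse_eval_trm) (auto simp: hd_tolerance_def day_terms_def)
  moreover have "(\<lambda>v. \<Gamma> v u) = env4 (\<gamma> (insert j (u - {i}))) (\<gamma> (u - {i})) (\<gamma> u) (\<gamma> (insert j u))"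
    if "u \<subseteq> S" for u
    using that ij by (intro ext) (auto simp: \<Gamma>_def env4_def refl_cube_False refl_cube_True)
  then have "(\<lambda>u\<in>Pow S. eval_trm F (\<lambda>v. \<Gamma> v u) t) = day_shift F S i j t \<gamma>"
    unfolding day_shift_def by (intro restrict_ext) auto
  ultimately show ?thesis by simp
qed

lemma day_shift_values:
  assumes "i \<noteq> j" "i \<in> S" "j \<in> S" "w \<subseteq> S" "i \<notin> w"
  shows "day_shift F S i j t \<gamma> (insert i w) = eval_trm F
      (env4 (\<gamma> (insert j w)) (\<gamma> w) (\<gamma> (insert i w)) (\<gamma> (insert i (insert j w)))) t"
    and "day_shift F S i j t \<gamma> (insert j (insert i w)) = eval_trm F (env4 (\<gamma> (insert j w))
      (\<gamma> (insert j w)) (\<gamma> (insert i (insert j w))) (\<gamma> (insert i (insert j w)))) t"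
proof -
  have "insert i w - {i} = w" "insert j (insert i w) = insert i (insert j w)"
    "insert i (insert j w) - {i} = insert j w"
    "insert j (insert i (insert j w)) = insert i (insert j w)"
    using assms by auto
  then show "day_shift F S i j t \<gamma> (insert i w) = eval_trm F
      (env4 (\<gamma> (insert j w)) (\<gamma> w) (\<gamma> (insert i w)) (\<gamma> (insert i (insert j w)))) t"
    and "day_shift F S i j t \<gamma> (insert j (insert i w)) = eval_trm F (env4 (\<gamma> (insert j w))
      (\<gamma> (insert j w)) (\<gamma> (insert i (insert j w))) (\<gamma> (insert i (insert j w)))) t"
    using assms by (simp_all add: day_shift_def)
qed

section \<open>Day shifts and centrality\<close>

context
  fixes ar :: "'f \<Rightarrow> nat" and A :: "'a set" and F :: "'f \<Rightarrow> 'a list \<Rightarrow> 'a"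
    and S :: "nat set" and \<delta> :: "'a rel"
  assumes alg: "algebra ar A F" and cm: "in_CM_variety ar A F" and \<delta>: "\<delta> \<in> Con ar A F"
begin

text \<open>Since \<open>t(x, y, y, x) = x\<close>, both ends equal
  \<open>\<gamma> (insert j u)\<close>.\<close>

lemma day_shift_line_off:
  assumes t: "t \<in> day_terms ar A F" and \<gamma>: "\<And>u. u \<subseteq> S \<Longrightarrow> \<gamma> u \<in> A" and ij: "i \<noteq> j" "j \<in> S"
    and u: "u \<subseteq> S" "i \<notin> u"
  shows "(day_shift F S i j t \<gamma> u, day_shift F S i j t \<gamma> (insert j u)) \<in> \<delta>"
proof -
  have "insert j u - {i} = insert j u" "u - {i} = u" using u ij by auto
  then show ?thesis using t u ij \<gamma>[of u] \<gamma>[of "insert j u"]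
    by (simp add: day_shift_def day_terms_def Con_refl[OF \<delta>])
qed

text \<open>Exchanging \<open>d\<close> for \<open>b\<close> and \<open>c\<close> for
  \<open>a\<close> modulo \<delta> turns the two ends into \<open>t(a, b, b, a)\<close> and
  \<open>t(a, a, a, a)\<close>, both equal to \<open>a\<close>.\<close>

lemma day_shift_line_on:
  assumes t: "t \<in> day_terms ar A F" and \<gamma>: "\<And>u. u \<subseteq> S \<Longrightarrow> \<gamma> u \<in> A"
    and ij: "i \<noteq> j" "i \<in> S" "j \<in> S" and w: "w \<subseteq> S" "i \<notin> w"
    and l0: "(\<gamma> w, \<gamma> (insert i w)) \<in> \<delta>"
    and l1: "(\<gamma> (insert j w), \<gamma> (insert i (insert j w))) \<in> \<delta>"
  shows "(day_shift F S i j t \<gamma> (insert i w), day_shift F S i j t \<gamma> (insert j (insert i w))) \<in> \<delta>"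
proof -
  define a b c d where abcd: "a = \<gamma> (insert j w)" "b = \<gamma> w" "c = \<gamma> (insert i (insert j w))"
    "d = \<gamma> (insert i w)"
  have A: "a \<in> A" "b \<in> A" "c \<in> A" "d \<in> A" unfolding abcd using ij w by (auto intro!: \<gamma>)
  have wf: "wf_trm ar t" using t by (simp add: day_terms_def)
  have "(eval_trm F (env4 a b d c) t, eval_trm F (env4 a b b a) t) \<in> \<delta>"
    using A l0 l1 wf abcd Con_sym[OF \<delta>]
    by (intro eval_trm_Con[OF \<delta>]) (auto simp: env4_def Con_refl[OF \<delta>])
  moreover have "(eval_trm F (env4 a a a a) t, eval_trm F (env4 a a c c) t) \<in> \<delta>"
    using A l0 l1 wf abcd
    by (intro eval_trm_Con[OF \<delta>]) (auto simp: env4_def Con_refl[OF \<delta>])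
  moreover have "eval_trm F (env4 a b b a) t = a" "eval_trm F (env4 a a a a) t = a"
    using t A by (auto simp: day_terms_def)
  ultimately have "(eval_trm F (env4 a b d c) t, eval_trm F (env4 a a c c) t) \<in> \<delta>"
    using Con_trans[OF \<delta>] by metis
  then show ?thesis using w ij by (simp add: day_shift_values abcd)
qed

text \<open>This is \<open>day_terms_separate\<close> read on one square of \<gamma>: a good line at
  \<open>w\<close> and good shifted lines for all Day terms yield the opposite line.\<close>

lemma day_shift_reflects:
  assumes \<gamma>: "\<And>u. u \<subseteq> S \<Longrightarrow> \<gamma> u \<in> A"
    and ij: "i \<noteq> j" "i \<in> S" "j \<in> S" and w: "w \<subseteq> S" "i \<notin> w"
    and l0: "(\<gamma> w, \<gamma> (insert i w)) \<in> \<delta>"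
    and T: "\<And>t. t \<in> day_terms ar A F \<Longrightarrow>
      (day_shift F S i j t \<gamma> (insert i w), day_shift F S i j t \<gamma> (insert j (insert i w))) \<in> \<delta>"
  shows "(\<gamma> (insert j w), \<gamma> (insert i (insert j w))) \<in> \<delta>"
proof (rule day_terms_separate[OF alg cm \<delta> _ _ l0])
  fix t assume "t \<in> day_terms ar A F"
  from T[OF this] show "(eval_trm F (env4 (\<gamma> (insert j w)) (\<gamma> w) (\<gamma> (insert i w)) (\<gamma> (insert i (insert j w)))) t,
      eval_trm F (env4 (\<gamma> (insert j w)) (\<gamma> (insert j w)) (\<gamma> (insert i (insert j w))) (\<gamma> (insert i (insert j w)))) t) \<in> \<delta>"
    using w ij by (simp add: day_shift_values)
qed (use ij w in \<open>auto intro!: \<gamma>\<close>)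

text \<open>If all \<open>i\<close>-supporting lines of \<gamma> are \<delta>-pairs, then so are all
  \<open>j\<close>-supporting lines of each of its shifts. Centrality in direction \<open>j\<close>
  gives the \<open>j\<close>-pivot lines, and these reflect back to the \<open>i\<close>-pivot
  line.\<close>

lemma central_at_change_direction:
  assumes R: "hd_tolerance ar A F S R" and ij: "i \<noteq> j" "i \<in> S" "j \<in> S"
    and cen: "central_at S \<delta> j R"
  shows "central_at S \<delta> i R"
  unfolding central_at_def
proof (intro ballI impI)
  fix \<gamma> assume \<gamma>R: "\<gamma> \<in> R"
    and supp: "\<forall>u. u \<subseteq> S - {i} \<and> u \<noteq> S - {i} \<longrightarrow> (\<gamma> u, \<gamma> (insert i u)) \<in> \<delta>"
  have \<gamma>: "\<gamma> u \<in> A" if "u \<subseteq> S" for u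
    using R \<gamma>R that by (auto simp: hd_tolerance_def intro: cube_subuniverse_value)
  \<comment> \<open>The square at \<open>?w\<close> carries both the \<open>i\<close>-pivot line of
    \<gamma> and the \<open>j\<close>-pivot line of its shift.\<close>
  let ?w = "S - {i, j}"
  have e: "insert j ?w = S - {i}" "insert i ?w = S - {j}" "insert i (S - {i}) = S" "insert j (S - {j}) = S"
    using ij by auto
  have "(\<gamma> (insert j ?w), \<gamma> (insert i (insert j ?w))) \<in> \<delta>"
  proof (rule day_shift_reflects)
    have "?w \<subseteq> S - {i}" "?w \<noteq> S - {i}" using ij by auto
    then show "(\<gamma> ?w, \<gamma> (insert i ?w)) \<in> \<delta>" using supp by simp
    fix t assume t: "t \<in> day_terms ar A F"
    let ?T = "day_shift F S i j t \<gamma>"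
    have "(?T u, ?T (insert j u)) \<in> \<delta>" if u: "u \<subseteq> S - {j}" "u \<noteq> S - {j}" for u
    proof (cases "i \<in> u")
      case False
      then show ?thesis using u ij by (intro day_shift_line_off[OF t \<gamma>]) auto
    next
      case True
      define w where "w = u - {i}"
      have w: "u = insert i w" "i \<notin> w" "w \<subseteq> S" "j \<notin> w" using True u by (auto simp: w_def)
      have ne: "w \<noteq> ?w" using w(1) u(2) e(2) by metis
      have wj: "insert j w \<subseteq> S - {i}" "insert j w \<noteq> S - {i}"
        using w ij ne by auto
      have wi: "w \<subseteq> S - {i}" "w \<noteq> S - {i}" using w ij by auto
      have "(?T (insert i w), ?T (insert j (insert i w))) \<in> \<delta>"
        using supp wi wj w ij by (intro day_shift_line_on[OF t \<gamma>]) simp_all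
      then show ?thesis using w by simp
    qed
    then have "(?T (S - {j}), ?T S) \<in> \<delta>"
      by (rule central_atD[OF cen day_shift_closed[OF R \<gamma>R ij(2,3,1) t]])
    then show "(?T (insert i ?w), ?T (insert j (insert i ?w))) \<in> \<delta>" using e by simp
  qed (use ij \<gamma> in auto)
  then show "(\<gamma> (S - {i}), \<gamma> S) \<in> \<delta>" using e by simp
qed

text \<open>\<open>\<gamma>1\<close> and \<open>\<gamma>2\<close> are stacked in direction \<open>k\<close>.  Nothing is known about the \<open>i\<close>-lines of the
  middle layer except at contexts not containing \<open>V\<close>; each shift from \<open>i\<close> to a new direction \<open>j\<close>
  enlarges \<open>V\<close> by \<open>i\<close>, until centrality of \<open>R\<close> applies to \<open>\<gamma>1\<close> and then to \<open>\<gamma>2\<close>.\<close>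
lemma stacked_pivot_line:
  assumes R: "hd_tolerance ar A F S R" and cen: "central S \<delta> R" and fin: "finite S" and k: "k \<in> S"
  shows "\<lbrakk>i \<in> S; i \<noteq> k; V \<subseteq> S - {i, k}; \<gamma>1 \<in> R; \<gamma>2 \<in> R;
     \<And>u. u \<subseteq> S - {k} \<Longrightarrow> \<gamma>1 (insert k u) = \<gamma>2 u;
     \<And>u. u \<subseteq> S - {i} \<Longrightarrow> \<not> V \<subseteq> u \<Longrightarrow> (\<gamma>1 u, \<gamma>1 (insert i u)) \<in> \<delta>;
     \<And>u. u \<subseteq> S - {i} \<Longrightarrow> \<not> V \<subseteq> u \<Longrightarrow> (\<gamma>2 u, \<gamma>2 (insert i u)) \<in> \<delta>;
     \<And>u. u \<subseteq> S - {i, k} \<Longrightarrow> (\<gamma>1 u, \<gamma>1 (insert i u)) \<in> \<delta>;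
     \<And>u. u \<subseteq> S - {i, k} \<Longrightarrow> u \<noteq> S - {i, k} \<Longrightarrow>
        (\<gamma>2 (insert k u), \<gamma>2 (insert i (insert k u))) \<in> \<delta>\<rbrakk>
    \<Longrightarrow> (\<gamma>2 (S - {i}), \<gamma>2 S) \<in> \<delta>"
proof (induction "card (S - {i, k} - V)" arbitrary: i V \<gamma>1 \<gamma>2)
  case 0
  note i = 0(2,3) and V = 0(4) and g = 0(5,6) and match = 0(7) and off1 = 0(8) and off2 = 0(9)
    and bot = 0(10)
  \<comment> \<open>Now only contexts containing \<open>S - {i, k}\<close> are in doubt. Centrality
    settles the pivot line of \<open>\<gamma>1\<close>, which is the line of
    \<open>\<gamma>2\<close> at \<open>S - {i, k}\<close>; this was the last supporting line missing
    for \<open>\<gamma>2\<close>.\<close>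
  have Veq: "V = S - {i, k}" using 0(1) V fin by auto
  have cases: "\<not> V \<subseteq> u \<or> u = S - {i, k}" if "u \<subseteq> S - {i}" "u \<noteq> S - {i}" for u
    using that Veq by auto
  have ci: "central_at S \<delta> i R" using cen i by (simp add: central_def)
  have "(\<gamma>1 (S - {i}), \<gamma>1 S) \<in> \<delta>"
  proof (rule central_atD[OF ci g(1)])
    fix u assume u: "u \<subseteq> S - {i}" "u \<noteq> S - {i}"
    show "(\<gamma>1 u, \<gamma>1 (insert i u)) \<in> \<delta>"
      using cases[OF u] off1[OF u(1)] bot[of u] by fastforce
  qed
  moreover have "\<gamma>1 (insert k (S - {i, k})) = \<gamma>2 (S - {i, k})" by (rule match) auto
  moreover have "\<gamma>1 (insert k (S - {k})) = \<gamma>2 (S - {k})" by (rule match) auto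
  moreover have "insert k (S - {i, k}) = S - {i}" "insert k (S - {k}) = S"
    "insert i (S - {i, k}) = S - {k}" using i k by auto
  ultimately have low: "(\<gamma>2 (S - {i, k}), \<gamma>2 (insert i (S - {i, k}))) \<in> \<delta>"
    by (simp only:)
  show ?case
  proof (rule central_atD[OF ci g(2)])
    fix u assume u: "u \<subseteq> S - {i}" "u \<noteq> S - {i}"
    show "(\<gamma>2 u, \<gamma>2 (insert i u)) \<in> \<delta>" using cases[OF u] off2[OF u(1)] low by fastforce
  qed
next
  case (Suc m)
  note i = Suc(3,4) and V = Suc(5) and g = Suc(6,7) and match = Suc(8) and off1 = Suc(9)
    and off2 = Suc(10) and bot = Suc(11) and top = Suc(12)
  have "S - {i, k} - V \<noteq> {}" using Suc(2) by force
  then obtain j where j: "j \<in> S" "j \<noteq> i" "j \<noteq> k" "j \<notin> V" by blast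
  have vals: "\<gamma>1 u \<in> A" "\<gamma>2 u \<in> A" if "u \<subseteq> S" for u
    using R g that by (auto simp: hd_tolerance_def intro: cube_subuniverse_value)
  let ?w = "S - {i, j}"
  have e: "insert j ?w = S - {i}" "insert i ?w = S - {j}" "insert i (S - {i}) = S" "insert j (S - {j}) = S"
    using i j by auto
  have "(\<gamma>2 (insert j ?w), \<gamma>2 (insert i (insert j ?w))) \<in> \<delta>"
  proof (rule day_shift_reflects[OF vals(2)])
    \<comment> \<open>As \<open>?w\<close> contains \<open>k\<close> but not \<open>j\<close>, its
      line lies in the top face of \<open>\<gamma>2\<close> and is not the pivot line.\<close>
    have "?w = insert k (S - {i, j, k})" using i j k by auto
    then show "(\<gamma>2 ?w, \<gamma>2 (insert i ?w)) \<in> \<delta>" using top[of "S - {i, j, k}"] i j by auto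
    fix t assume t: "t \<in> day_terms ar A F"
    let ?T1 = "day_shift F S i j t \<gamma>1" and ?T2 = "day_shift F S i j t \<gamma>2"
    have off: "(?T1 u, ?T1 (insert j u)) \<in> \<delta>" "(?T2 u, ?T2 (insert j u)) \<in> \<delta>"
      if "u \<subseteq> S" "i \<notin> u" for u
      using that j by (auto intro!: day_shift_line_off[OF t] vals)
    have on1: "(?T1 (insert i w), ?T1 (insert j (insert i w))) \<in> \<delta>"
      if "w \<subseteq> S" "i \<notin> w" "(\<gamma>1 w, \<gamma>1 (insert i w)) \<in> \<delta>"
        "(\<gamma>1 (insert j w), \<gamma>1 (insert i (insert j w))) \<in> \<delta>" for w
      using j(2)[symmetric] i(1) j(1) that by (intro day_shift_line_on[OF t] vals)
    have on2: "(?T2 (insert i w), ?T2 (insert j (insert i w))) \<in> \<delta>"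
      if "w \<subseteq> S" "i \<notin> w" "(\<gamma>2 w, \<gamma>2 (insert i w)) \<in> \<delta>"
        "(\<gamma>2 (insert j w), \<gamma>2 (insert i (insert j w))) \<in> \<delta>" for w
      using j(2)[symmetric] i(1) j(1) that by (intro day_shift_line_on[OF t] vals)
    have "(?T2 (S - {j}), ?T2 S) \<in> \<delta>"
    proof (rule Suc(1)[where i = j and V = "insert i V" and ?\<gamma>1.0 = ?T1])
      have "S - {i, k} - V = insert j (S - {j, k} - insert i V)" using i j by auto
      then show "m = card (S - {j, k} - insert i V)" using Suc(2) fin by simp
      show "j \<in> S" "j \<noteq> k" "insert i V \<subseteq> S - {j, k}" using i j V by auto
      show "?T1 \<in> R" "?T2 \<in> R" using day_shift_closed[OF R _ _ _ _ t] g i j by auto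
    next
      fix u assume u: "u \<subseteq> S - {k}"
      \<comment> \<open>The shift involves only \<open>i\<close> and \<open>j\<close>, so the
        shifted cubes still match along \<open>k\<close>.\<close>
      have *: "insert k u - {i} = insert k (u - {i})" "insert j (insert k x) = insert k (insert j x)" for x
        using i by auto
      have "\<gamma>1 (insert k u) = \<gamma>2 u" "\<gamma>1 (insert k (u - {i})) = \<gamma>2 (u - {i})"
        "\<gamma>1 (insert k (insert j u)) = \<gamma>2 (insert j u)"
        "\<gamma>1 (insert k (insert j (u - {i}))) = \<gamma>2 (insert j (u - {i}))"
        using u j by (auto intro!: match)
      then show "?T1 (insert k u) = ?T2 u" using u k by (auto simp: day_shift_def *)
    next
      fix u assume u: "u \<subseteq> S - {j}" "\<not> insert i V \<subseteq> u"
      have "(?T1 u, ?T1 (insert j u)) \<in> \<delta> \<and> (?T2 u, ?T2 (insert j u)) \<in> \<delta>"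
      proof (cases "i \<in> u")
        case False
        then show ?thesis using u by (auto intro: off)
      next
        case True
        then obtain w where w: "u = insert i w" "i \<notin> w" by (rule Set.set_insert)
        have wS: "w \<subseteq> S" "w \<subseteq> S - {i}" "insert j w \<subseteq> S - {i}" using u w j by auto
        \<comment> \<open>Here \<open>j\<close> being outside \<open>V\<close> matters: adding
          \<open>j\<close> to \<open>w\<close> cannot complete \<open>V\<close>.\<close>
        have "\<not> V \<subseteq> w" "\<not> V \<subseteq> insert j w" using u w j by auto
        then show ?thesis
          unfolding w(1) using on1[OF wS(1) w(2)] on2[OF wS(1) w(2)] off1 off2 wS by simp
      qed
      then show "(?T1 u, ?T1 (insert j u)) \<in> \<delta>" "(?T2 u, ?T2 (insert j u)) \<in> \<delta>" by auto
    next
      fix u assume u: "u \<subseteq> S - {j, k}"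
      show "(?T1 u, ?T1 (insert j u)) \<in> \<delta>"
      proof (cases "i \<in> u")
        case False
        then show ?thesis using u by (intro off) auto
      next
        case True
        then obtain w where w: "u = insert i w" "i \<notin> w" by (rule Set.set_insert)
        have wS: "w \<subseteq> S" "w \<subseteq> S - {i, k}" "insert j w \<subseteq> S - {i, k}" using u w j by auto
        show ?thesis unfolding w(1) using on1[OF wS(1) w(2)] bot wS by simp
      qed
    next
      fix u assume u: "u \<subseteq> S - {j, k}" "u \<noteq> S - {j, k}"
      show "(?T2 (insert k u), ?T2 (insert j (insert k u))) \<in> \<delta>"
      proof (cases "i \<in> u")
        case False
        then show ?thesis using u i k by (intro off) auto
      next
        case True
        then obtain w where w: "u = insert i w" "i \<notin> w" by (rule Set.set_insert)
        have wS: "insert k w \<subseteq> S" "i \<notin> insert k w" "w \<subseteq> S - {i, k}" "insert j w \<subseteq> S - {i, k}"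
          using u w i j k by auto
        have "w \<noteq> S - {i, k}" using u w j by auto
        moreover have "insert j w \<noteq> S - {i, k}"
        proof
          assume "insert j w = S - {i, k}"
          then have "u = S - {j, k}" using u(1) w i by auto
          then show False using u(2) by simp
        qed
        ultimately have "(?T2 (insert i (insert k w)), ?T2 (insert j (insert i (insert k w)))) \<in> \<delta>"
          using wS top[of w] top[of "insert j w"] by (intro on2) (simp_all add: insert_commute)
        then show ?thesis unfolding w(1) by (simp add: insert_commute)
      qed
    qed
    then show "(?T2 (insert i ?w), ?T2 (insert j (insert i ?w))) \<in> \<delta>" using e by simp
  qed (use i j in auto)
  then show ?case using e by simp
qed

subsection \<open>Composing cubes along a direction\<close>

text \<open>For \<open>k \<in> S\<close> this encodes as cubes the relational composition of
  \<open>face_rel S k R\<close> with itself.\<close>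

definition cube_comp :: "nat \<Rightarrow> (nat set \<Rightarrow> 'a) set \<Rightarrow> (nat set \<Rightarrow> 'a) set" where
  "cube_comp k R = {\<lambda>u\<in>Pow S. if k \<in> u then \<gamma>2 u else \<gamma>1 u | \<gamma>1 \<gamma>2.
     \<gamma>1 \<in> R \<and> \<gamma>2 \<in> R \<and> (\<forall>u. u \<subseteq> S - {k} \<longrightarrow> \<gamma>1 (insert k u) = \<gamma>2 u)}"

lemma cube_compI:
  assumes "\<gamma>1 \<in> R" "\<gamma>2 \<in> R" "\<And>u. u \<subseteq> S - {k} \<Longrightarrow> \<gamma>1 (insert k u) = \<gamma>2 u"
    and "\<gamma> = (\<lambda>u\<in>Pow S. if k \<in> u then \<gamma>2 u else \<gamma>1 u)"
  shows "\<gamma> \<in> cube_comp k R"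
  using assms unfolding cube_comp_def by blast

lemma cube_compE:
  assumes "\<gamma> \<in> cube_comp k R"
  obtains \<gamma>1 \<gamma>2 where "\<gamma>1 \<in> R" "\<gamma>2 \<in> R" "\<And>u. u \<subseteq> S - {k} \<Longrightarrow> \<gamma>1 (insert k u) = \<gamma>2 u"
    and "\<gamma> = (\<lambda>u\<in>Pow S. if k \<in> u then \<gamma>2 u else \<gamma>1 u)"
  using assms unfolding cube_comp_def by blast

text \<open>A cube is its own composite with the degenerate cube on its upper
  \<open>k\<close>-face.\<close>

lemma subset_cube_comp:
  assumes R: "hd_tolerance ar A F S R" and k: "k \<in> S"
  shows "R \<subseteq> cube_comp k R"
proof
  fix \<gamma> assume \<gamma>: "\<gamma> \<in> R"
  then have "\<gamma> \<in> Pow S \<rightarrow>\<^sub>E A" using R by (auto simp: hd_tolerance_def cube_subuniverse_def cubes_def)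
  then have r: "(\<lambda>u\<in>Pow S. \<gamma> u) = \<gamma>" by (rule PiE_restrict)
  show "\<gamma> \<in> cube_comp k R"
  proof (rule cube_compI)
    show "\<gamma> \<in> R" "refl_cube S k True \<gamma> \<in> R" using R k \<gamma> by (auto simp: hd_tolerance_def)
    show "\<gamma> (insert k u) = refl_cube S k True \<gamma> u" if "u \<subseteq> S - {k}" for u
      using that k by (auto simp: refl_cube_True)
    show "\<gamma> = (\<lambda>u\<in>Pow S. if k \<in> u then refl_cube S k True \<gamma> u else \<gamma> u)"
      using k by (subst r[symmetric], intro restrict_ext) (auto simp: refl_cube_True insert_absorb)
  qed
qed

lemma cube_comp_subuniverse:
  assumes R: "cube_subuniverse ar A F S R" and k: "k \<in> S"
  shows "cube_subuniverse ar A F S (cube_comp k R)"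
  unfolding cube_subuniverse_def
proof (intro conjI allI impI)
  show "cube_comp k R \<subseteq> cubes S A"
  proof
    fix \<gamma> assume "\<gamma> \<in> cube_comp k R"
    then show "\<gamma> \<in> cubes S A"
      by (rule cube_compE) (simp add: cubes_def cube_subuniverse_value[OF R])
  qed
next
  fix f \<gamma>s assume h: "length \<gamma>s = ar f \<and> set \<gamma>s \<subseteq> cube_comp k R"
  have "\<forall>\<gamma>\<in>set \<gamma>s. \<exists>\<gamma>1 \<gamma>2. \<gamma>1 \<in> R \<and> \<gamma>2 \<in> R \<and> (\<forall>u. u \<subseteq> S - {k} \<longrightarrow> \<gamma>1 (insert k u) = \<gamma>2 u) \<and>
      \<gamma> = (\<lambda>u\<in>Pow S. if k \<in> u then \<gamma>2 u else \<gamma>1 u)"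
    using h unfolding cube_comp_def by blast
  \<comment> \<open>\<open>p\<close> and \<open>q\<close> choose the lower and upper components of
    each argument; the operation is then applied to each layer separately.\<close>
  from bchoice[OF this] obtain p where
    "\<forall>\<gamma>\<in>set \<gamma>s. \<exists>\<gamma>2. p \<gamma> \<in> R \<and> \<gamma>2 \<in> R \<and> (\<forall>u. u \<subseteq> S - {k} \<longrightarrow> p \<gamma> (insert k u) = \<gamma>2 u) \<and>
      \<gamma> = (\<lambda>u\<in>Pow S. if k \<in> u then \<gamma>2 u else p \<gamma> u)" ..
  from bchoice[OF this] obtain q where
    "\<forall>\<gamma>\<in>set \<gamma>s. p \<gamma> \<in> R \<and> q \<gamma> \<in> R \<and> (\<forall>u. u \<subseteq> S - {k} \<longrightarrow> p \<gamma> (insert k u) = q \<gamma> u) \<and>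
      \<gamma> = (\<lambda>u\<in>Pow S. if k \<in> u then q \<gamma> u else p \<gamma> u)" ..
  note pq = bspec[OF this]
  have val: "\<gamma> u = (if k \<in> u then q \<gamma> u else p \<gamma> u)" if "\<gamma> \<in> set \<gamma>s" "u \<subseteq> S" for \<gamma> u
  proof -
    have "\<gamma> = (\<lambda>u\<in>Pow S. if k \<in> u then q \<gamma> u else p \<gamma> u)" using pq[OF that(1)] by blast
    from fun_cong[OF this, of u] show ?thesis using that(2) by (simp only: restrict_apply' PowI)
  qed
  let ?op = "\<lambda>gs. \<lambda>u\<in>Pow S. F f (map (\<lambda>\<gamma>. \<gamma> u) gs)"
  show "?op \<gamma>s \<in> cube_comp k R"
  proof (rule cube_compI)
    have "length (map p \<gamma>s) = ar f" "set (map p \<gamma>s) \<subseteq> R" "length (map q \<gamma>s) = ar f" "set (map q \<gamma>s) \<subseteq> R"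
      using h pq by auto
    then show "?op (map p \<gamma>s) \<in> R" "?op (map q \<gamma>s) \<in> R"
      using R unfolding cube_subuniverse_def by blast+
    show "?op (map p \<gamma>s) (insert k u) = ?op (map q \<gamma>s) u" if u: "u \<subseteq> S - {k}" for u
    proof -
      have "map (\<lambda>\<gamma>. \<gamma> (insert k u)) (map p \<gamma>s) = map (\<lambda>\<gamma>. \<gamma> u) (map q \<gamma>s)"
        using pq u by auto
      moreover have "insert k u \<subseteq> S" "u \<subseteq> S" using u k by auto
      ultimately show ?thesis by (simp del: map_map map_eq_conv)
    qed
    show "?op \<gamma>s = (\<lambda>u\<in>Pow S. if k \<in> u then ?op (map q \<gamma>s) u else ?op (map p \<gamma>s) u)"
      by (intro restrict_ext) (auto simp: val comp_def cong: map_cong)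
  qed
qed

lemma cube_comp_tolerance:
  assumes R: "hd_tolerance ar A F S R" and k: "k \<in> S"
  shows "hd_tolerance ar A F S (cube_comp k R)"
proof -
  have sub: "cube_subuniverse ar A F S R" using R by (simp add: hd_tolerance_def)
  have Rrefl: "refl_cube S i j \<gamma> \<in> R" and Rsym: "sym_cube S i \<gamma> \<in> R" if "\<gamma> \<in> R" "i \<in> S" for i j \<gamma>
    using R that by (auto simp: hd_tolerance_def)
  have "refl_cube S i j \<gamma> \<in> cube_comp k R \<and> sym_cube S i \<gamma> \<in> cube_comp k R"
    if \<gamma>: "\<gamma> \<in> cube_comp k R" and i: "i \<in> S" for \<gamma> i j
  proof -
    from \<gamma> obtain \<gamma>1 \<gamma>2 where g: "\<gamma>1 \<in> R" "\<gamma>2 \<in> R"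
      and match: "\<And>u. u \<subseteq> S - {k} \<Longrightarrow> \<gamma>1 (insert k u) = \<gamma>2 u"
      and eq: "\<gamma> = (\<lambda>u\<in>Pow S. if k \<in> u then \<gamma>2 u else \<gamma>1 u)"
      unfolding cube_comp_def by blast
    show ?thesis
    proof (cases "i = k")
      case True
      \<comment> \<open>In direction \<open>k\<close> a degeneracy sees only one of the outer faces,
        hence one component; the symmetry reverses both components and swaps them.\<close>
      have "refl_cube S k j \<gamma> = refl_cube S k j (if j then \<gamma>2 else \<gamma>1)"
        using k by (cases j) (auto simp: refl_cube_False refl_cube_True eq intro!: restrict_ext)
      moreover have "refl_cube S k j (if j then \<gamma>2 else \<gamma>1) \<in> R" using g k by (simp add: Rrefl)
      moreover have "sym_cube S k \<gamma> \<in> cube_comp k R"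
      proof (rule cube_compI)
        show "sym_cube S k \<gamma>2 \<in> R" "sym_cube S k \<gamma>1 \<in> R" using g k by (auto intro: Rsym)
        show "sym_cube S k \<gamma>2 (insert k u) = sym_cube S k \<gamma>1 u" if u: "u \<subseteq> S - {k}" for u
        proof -
          have "u - {k} = u" "k \<notin> u" "insert k u \<subseteq> S" "u \<subseteq> S" using u k by auto
          then show ?thesis using match[OF u] k by (simp add: sym_cube_eq)
        qed
        show "sym_cube S k \<gamma> = (\<lambda>u\<in>Pow S. if k \<in> u then sym_cube S k \<gamma>1 u else sym_cube S k \<gamma>2 u)"
          using k by (auto simp: sym_cube_eq eq intro!: restrict_ext)
      qed
      ultimately show ?thesis using True subset_cube_comp[OF R k] by auto
    next
      case False
      \<comment> \<open>Degeneracies and symmetry in direction \<open>i\<close> only reindex by a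
        map \<open>h\<close> that leaves coordinate \<open>k\<close> alone, so they act on the two
        components separately.\<close>
      have *: "(\<lambda>u\<in>Pow S. \<gamma> (h u)) \<in> cube_comp k R"
        if h: "\<And>\<gamma>'. \<gamma>' \<in> R \<Longrightarrow> (\<lambda>u\<in>Pow S. \<gamma>' (h u)) \<in> R"
          and hS: "\<And>u. u \<subseteq> S \<Longrightarrow> h u \<subseteq> S" and hk: "\<And>u. h (insert k u) = insert k (h u)"
          and hk': "\<And>u. k \<in> h u \<longleftrightarrow> k \<in> u" for h
      proof (rule cube_compI[OF h[OF g(1)] h[OF g(2)]])
        fix u assume u: "u \<subseteq> S - {k}"
        then have "h u \<subseteq> S - {k}" using hS[of u] hk'[of u] by auto
        then show "(\<lambda>u\<in>Pow S. \<gamma>1 (h u)) (insert k u) = (\<lambda>u\<in>Pow S. \<gamma>2 (h u)) u"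
          using u k by (auto simp: hk match)
      next
        show "(\<lambda>u\<in>Pow S. \<gamma> (h u)) =
          (\<lambda>u\<in>Pow S. if k \<in> u then (\<lambda>u\<in>Pow S. \<gamma>2 (h u)) u else (\<lambda>u\<in>Pow S. \<gamma>1 (h u)) u)"
          using hS by (auto simp: eq hk' intro!: restrict_ext)
      qed
      have "refl_cube S i j \<gamma> \<in> cube_comp k R"
      proof (cases j)
        case True
        have "(\<lambda>u\<in>Pow S. \<gamma> (insert i u)) \<in> cube_comp k R"
          using i False Rrefl[of _ i True] by (intro *) (auto simp: refl_cube_True)
        then show ?thesis using True i by (simp add: refl_cube_True)
      next
        case jF: False
        have "(\<lambda>u\<in>Pow S. \<gamma> (u - {i})) \<in> cube_comp k R"
          using i False Rrefl[of _ i False] by (intro *) (auto simp: refl_cube_False)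
        then show ?thesis using jF i by (simp add: refl_cube_False)
      qed
      moreover have "(\<lambda>u\<in>Pow S. \<gamma> (if i \<in> u then u - {i} else insert i u)) \<in> cube_comp k R"
        using i False Rsym[of _ i] by (intro *) (auto simp: sym_cube_eq)
      ultimately show ?thesis using i by (simp add: sym_cube_eq)
    qed
  qed
  then show ?thesis using cube_comp_subuniverse[OF sub k] by (simp add: hd_tolerance_def)
qed

text \<open>Directions other than \<open>k\<close> follow from \<open>stacked_pivot_line\<close>;
  direction \<open>k\<close> follows from any other one by
  \<open>central_at_change_direction\<close>.\<close>

lemma cube_comp_central:
  assumes R: "hd_tolerance ar A F S R" and cen: "central S \<delta> R" and fin: "finite S"
    and k: "k \<in> S" and S2: "S \<noteq> {k}"
  shows "central S \<delta> (cube_comp k R)"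
proof -
  have other: "central_at S \<delta> i (cube_comp k R)" if i: "i \<in> S" "i \<noteq> k" for i
    unfolding central_at_def
  proof (intro ballI impI)
    fix \<gamma> assume "\<gamma> \<in> cube_comp k R"
      and supp: "\<forall>u. u \<subseteq> S - {i} \<and> u \<noteq> S - {i} \<longrightarrow> (\<gamma> u, \<gamma> (insert i u)) \<in> \<delta>"
    then obtain \<gamma>1 \<gamma>2 where g: "\<gamma>1 \<in> R" "\<gamma>2 \<in> R"
      and match: "\<And>u. u \<subseteq> S - {k} \<Longrightarrow> \<gamma>1 (insert k u) = \<gamma>2 u"
      and eq: "\<gamma> = (\<lambda>u\<in>Pow S. if k \<in> u then \<gamma>2 u else \<gamma>1 u)" by (auto elim: cube_compE)
    have "(\<gamma>2 (S - {i}), \<gamma>2 S) \<in> \<delta>"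
    \<comment> \<open>With \<open>V = {}\<close> the assumptions on contexts not containing
      \<open>V\<close> are vacuous: only the outer layers are known.\<close>
    proof (rule stacked_pivot_line[OF R cen fin k i, where V = "{}" and ?\<gamma>1.0 = \<gamma>1])
      fix u assume u: "u \<subseteq> S - {i, k}"
      then have "u \<subseteq> S - {i}" "u \<noteq> S - {i}" using i k by auto
      then have "(\<gamma> u, \<gamma> (insert i u)) \<in> \<delta>" using supp by blast
      moreover have "u \<subseteq> S" "insert i u \<subseteq> S" "k \<notin> u" "k \<notin> insert i u" using u i by auto
      ultimately show "(\<gamma>1 u, \<gamma>1 (insert i u)) \<in> \<delta>" by (simp add: eq)
    next
      fix u assume u: "u \<subseteq> S - {i, k}" "u \<noteq> S - {i, k}"
      then have "insert k u \<subseteq> S - {i}" "insert k u \<noteq> S - {i}" using i k by auto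
      then have "(\<gamma> (insert k u), \<gamma> (insert i (insert k u))) \<in> \<delta>" using supp by blast
      moreover have "insert k u \<subseteq> S" "insert i (insert k u) \<subseteq> S" using u i k by auto
      ultimately show "(\<gamma>2 (insert k u), \<gamma>2 (insert i (insert k u))) \<in> \<delta>" by (simp add: eq)
    qed (use g match in auto)
    then show "(\<gamma> (S - {i}), \<gamma> S) \<in> \<delta>" using i k by (auto simp: eq)
  qed
  obtain j where "j \<in> S" "j \<noteq> k" using S2 k by blast
  then have "central_at S \<delta> k (cube_comp k R)"
    using central_at_change_direction[OF cube_comp_tolerance[OF R k] _ k _ other, of j] by auto
  then show ?thesis using other unfolding central_def by blast
qed

lemma trans_face_rel:
  assumes R: "cube_comp k R \<subseteq> R" and k: "k \<in> S"
  shows "trans (face_rel S k R)"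
proof (rule transI)
  fix x y z assume "(x, y) \<in> face_rel S k R" "(y, z) \<in> face_rel S k R"
  then obtain \<gamma>1 \<gamma>2 where g: "\<gamma>1 \<in> R" "\<gamma>2 \<in> R"
    and x: "x = face S k False \<gamma>1" and y: "face S k True \<gamma>1 = face S k False \<gamma>2"
    and z: "z = face S k True \<gamma>2" by (auto simp: face_rel_def)
  let ?\<gamma> = "\<lambda>u\<in>Pow S. if k \<in> u then \<gamma>2 u else \<gamma>1 u"
  have "\<gamma>1 (insert k u) = \<gamma>2 u" if "u \<subseteq> S - {k}" for u
    using fun_cong[OF y, of u] that by (simp add: face_def)
  then have "?\<gamma> \<in> R" using cube_compI[OF g _ refl] R by blast
  moreover have "face S k False ?\<gamma> = x" "face S k True ?\<gamma> = z"
    unfolding x z face_def using k by (auto intro!: restrict_ext)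
  ultimately show "(x, z) \<in> face_rel S k R" unfolding face_rel_def by blast
qed

text \<open>Zorn's lemma applies because centrality is tested on single cubes and operations are
  finitary, so both survive unions of chains. Composition enlarges a central tolerance to a central
  tolerance, hence fixes a maximal one.\<close>

lemma central_congruence_above:
  assumes M: "hd_tolerance ar A F S M" and cen: "central S \<delta> M" and fin: "finite S"
    and S2: "\<And>k. S \<noteq> {k}"
  obtains R where "hd_congruence ar A F S R" "central S \<delta> R" "M \<subseteq> R"
proof -
  define \<A> where "\<A> = {R. hd_tolerance ar A F S R \<and> central S \<delta> R \<and> M \<subseteq> R}"
  have "\<exists>R\<in>\<A>. \<forall>X\<in>\<A>. R \<subseteq> X \<longrightarrow> X = R"
  proof (rule subset_Zorn_nonempty)
    show "\<A> \<noteq> {}" using M cen by (auto simp: \<A>_def)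
  next
    fix \<C> assume \<C>: "\<C> \<noteq> {}" "subset.chain \<A> \<C>"
    then have mem: "hd_tolerance ar A F S C" "central S \<delta> C" "M \<subseteq> C" if "C \<in> \<C>" for C
      using that by (auto simp: \<A>_def subset.chain_def)
    have "cube_subuniverse ar A F S (\<Union>\<C>)"
      unfolding cube_subuniverse_def
    proof (intro conjI allI impI)
      show "\<Union>\<C> \<subseteq> cubes S A" using mem(1) unfolding hd_tolerance_def cube_subuniverse_def by blast
      fix f \<gamma>s assume h: "length \<gamma>s = ar f \<and> set \<gamma>s \<subseteq> \<Union>\<C>"
      then obtain C where "C \<in> \<C>" "set \<gamma>s \<subseteq> C"
        using finite_subset_Union_chain[OF finite_set _ \<C>] by blast
      then show "(\<lambda>u\<in>Pow S. F f (map (\<lambda>\<gamma>. \<gamma> u) \<gamma>s)) \<in> \<Union>\<C>"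
        using mem(1) h unfolding hd_tolerance_def cube_subuniverse_def by blast
    qed
    then have "hd_tolerance ar A F S (\<Union>\<C>)"
      using mem(1) unfolding hd_tolerance_def by blast
    moreover have "central S \<delta> (\<Union>\<C>)"
      using mem(2) unfolding central_def central_at_def by blast
    ultimately show "\<Union>\<C> \<in> \<A>" using \<C>(1) mem(3) by (auto simp: \<A>_def)
  qed
  then obtain R where R: "R \<in> \<A>" and max: "\<And>X. X \<in> \<A> \<Longrightarrow> R \<subseteq> X \<Longrightarrow> X = R" by blast
  have tol: "hd_tolerance ar A F S R" "central S \<delta> R" "M \<subseteq> R" using R by (auto simp: \<A>_def)
  have "cube_comp k R = R" if "k \<in> S" for k
  proof (rule max)
    show sub: "R \<subseteq> cube_comp k R" using subset_cube_comp[OF tol(1) that] .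
    then show "cube_comp k R \<in> \<A>"
      using cube_comp_tolerance[OF tol(1) that] cube_comp_central[OF tol(1,2) fin that S2] tol(3)
      by (auto simp: \<A>_def)
  qed
  then have "hd_congruence ar A F S R"
    using tol(1) trans_face_rel by (auto simp: hd_congruence_def)
  then show thesis using tol that by blast
qed

end

subsection \<open>The two commutators\<close>

lemma M_rel_generators:
  "k \<in> S \<Longrightarrow> (x, y) \<in> \<theta> k \<Longrightarrow> cube_k S k x y \<in> M_rel ar A F S \<theta>"
  unfolding M_rel_def by blast

lemma M_rel_least:
  "cube_subuniverse ar A F S R \<Longrightarrow> (\<And>k x y. k \<in> S \<Longrightarrow> (x, y) \<in> \<theta> k \<Longrightarrow> cube_k S k x y \<in> R) \<Longrightarrow>
    M_rel ar A F S \<theta> \<subseteq> R"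
  unfolding M_rel_def by blast

lemma M_rel_subuniverse:
  assumes alg: "algebra ar A F" and \<theta>: "\<And>k. k \<in> S \<Longrightarrow> \<theta> k \<in> Con ar A F"
  shows "cube_subuniverse ar A F S (M_rel ar A F S \<theta>)"
proof -
  have "cube_subuniverse ar A F S (cubes S A)"
    unfolding cube_subuniverse_def
  proof (intro conjI allI impI subset_refl)
    fix f \<gamma>s assume h: "length \<gamma>s = ar f \<and> set \<gamma>s \<subseteq> cubes S A"
    have "F f (map (\<lambda>\<gamma>. \<gamma> u) \<gamma>s) \<in> A" if u: "u \<subseteq> S" for u
    proof -
      have "set (map (\<lambda>\<gamma>. \<gamma> u) \<gamma>s) \<subseteq> A" using h u by (auto simp: cubes_def)
      then show ?thesis using alg h by (simp add: algebra_def)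
    qed
    then show "(\<lambda>u\<in>Pow S. F f (map (\<lambda>\<gamma>. \<gamma> u) \<gamma>s)) \<in> cubes S A" by (auto simp: cubes_def)
  qed
  moreover have "cube_k S k x y \<in> cubes S A" if "k \<in> S" "(x, y) \<in> \<theta> k" for k x y
    using Con_subset[OF \<theta>[OF that(1)]] that(2) by (auto simp: cube_k_def cubes_def)
  ultimately have "M_rel ar A F S \<theta> \<subseteq> cubes S A" by (intro M_rel_least)
  then show ?thesis unfolding cube_subuniverse_def M_rel_def by blast
qed

text \<open>The cubes of \<open>M\<close> whose reindexing stays in \<open>M\<close> form a
  subuniverse containing the generators.\<close>

lemma M_rel_reindex:
  assumes alg: "algebra ar A F" and \<theta>: "\<And>k. k \<in> S \<Longrightarrow> \<theta> k \<in> Con ar A F"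
    and hS: "\<And>u. u \<subseteq> S \<Longrightarrow> h u \<subseteq> S"
    and gens: "\<And>k x y. k \<in> S \<Longrightarrow> (x, y) \<in> \<theta> k \<Longrightarrow>
      (\<lambda>u\<in>Pow S. if k \<in> h u then y else x) \<in> M_rel ar A F S \<theta>"
    and \<gamma>: "\<gamma> \<in> M_rel ar A F S \<theta>"
  shows "(\<lambda>u\<in>Pow S. \<gamma> (h u)) \<in> M_rel ar A F S \<theta>"
proof -
  let ?M = "M_rel ar A F S \<theta>"
  have M: "cube_subuniverse ar A F S ?M" using alg \<theta> by (rule M_rel_subuniverse)
  let ?R = "{\<gamma> \<in> ?M. (\<lambda>u\<in>Pow S. \<gamma> (h u)) \<in> ?M}"
  have "?M \<subseteq> ?R"
  proof (rule M_rel_least)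
    show "cube_subuniverse ar A F S ?R"
      unfolding cube_subuniverse_def
    proof (intro conjI allI impI)
      show "?R \<subseteq> cubes S A" using M by (auto simp: cube_subuniverse_def)
      fix f \<gamma>s assume g: "length \<gamma>s = ar f \<and> set \<gamma>s \<subseteq> ?R"
      let ?op = "\<lambda>gs. \<lambda>u\<in>Pow S. F f (map (\<lambda>\<gamma>. \<gamma> u) gs)"
      have cl: "?op gs \<in> ?M" if "length gs = ar f" "set gs \<subseteq> ?M" for gs
        using M that unfolding cube_subuniverse_def by blast
      have "?op (map (\<lambda>\<gamma>. \<lambda>u\<in>Pow S. \<gamma> (h u)) \<gamma>s) \<in> ?M" using g by (intro cl) auto
      moreover have "?op (map (\<lambda>\<gamma>. \<lambda>u\<in>Pow S. \<gamma> (h u)) \<gamma>s) = (\<lambda>u\<in>Pow S. ?op \<gamma>s (h u))"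
        using hS by (intro restrict_ext) (auto simp: comp_def)
      ultimately show "?op \<gamma>s \<in> ?R" using cl[of \<gamma>s] g by auto
    qed
    fix k x y assume k: "k \<in> S" and xy: "(x, y) \<in> \<theta> k"
    have "(\<lambda>u\<in>Pow S. cube_k S k x y (h u)) = (\<lambda>u\<in>Pow S. if k \<in> h u then y else x)"
      using hS by (intro restrict_ext) (auto simp: cube_k_def)
    then show "cube_k S k x y \<in> ?R" using gens[OF k xy] M_rel_generators[OF k] xy by simp
  qed
  then show ?thesis using \<gamma> by blast
qed

lemma M_rel_tolerance:
  assumes alg: "algebra ar A F" and \<theta>: "\<And>k. k \<in> S \<Longrightarrow> \<theta> k \<in> Con ar A F"
  shows "hd_tolerance ar A F S (M_rel ar A F S \<theta>)"
proof -
  let ?M = "M_rel ar A F S \<theta>"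
  have gen: "(\<lambda>u\<in>Pow S. if k \<in> u then y else x) \<in> ?M" if "k \<in> S" "(x, y) \<in> \<theta> k" for k x y
    using M_rel_generators[of k S x y \<theta>] that by (simp add: cube_k_def)
  have refl: "(x, x) \<in> \<theta> k" "(y, y) \<in> \<theta> k" "(y, x) \<in> \<theta> k" if "k \<in> S" "(x, y) \<in> \<theta> k" for k x y
    using Con_subset[OF \<theta>] Con_refl[OF \<theta>] Con_sym[OF \<theta>] that by blast+
  have gens: "(\<lambda>u\<in>Pow S. if k \<in> insert i u then y else x) \<in> ?M"
    "(\<lambda>u\<in>Pow S. if k \<in> u - {i} then y else x) \<in> ?M"
    "(\<lambda>u\<in>Pow S. if k \<in> (if i \<in> u then u - {i} else insert i u) then y else x) \<in> ?M"
    if kxy: "k \<in> S" "(x, y) \<in> \<theta> k" for i k x y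
  proof -
    \<comment> \<open>For \<open>k = i\<close> the reindexed generator comes from
      \<open>(y, y)\<close>, \<open>(x, x)\<close> or \<open>(y, x)\<close>; for other
      \<open>k\<close> it is unchanged.\<close>
    have pairs: "(if k = i then y else x, y) \<in> \<theta> k" "(x, if k = i then x else y) \<in> \<theta> k"
      "(if k = i then y else x, if k = i then x else y) \<in> \<theta> k"
      using kxy refl[OF kxy] by auto
    have "(\<lambda>u\<in>Pow S. if k \<in> insert i u then y else x) =
        (\<lambda>u\<in>Pow S. if k \<in> u then y else (if k = i then y else x))"
      "(\<lambda>u\<in>Pow S. if k \<in> u - {i} then y else x) =
        (\<lambda>u\<in>Pow S. if k \<in> u then (if k = i then x else y) else x)"
      "(\<lambda>u\<in>Pow S. if k \<in> (if i \<in> u then u - {i} else insert i u) then y else x) =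
        (\<lambda>u\<in>Pow S. if k \<in> u then (if k = i then x else y) else (if k = i then y else x))"
      by (auto intro!: restrict_ext)
    then show "(\<lambda>u\<in>Pow S. if k \<in> insert i u then y else x) \<in> ?M"
      "(\<lambda>u\<in>Pow S. if k \<in> u - {i} then y else x) \<in> ?M"
      "(\<lambda>u\<in>Pow S. if k \<in> (if i \<in> u then u - {i} else insert i u) then y else x) \<in> ?M"
      using pairs[THEN gen[OF kxy(1)]] by (simp_all only:)
  qed
  note re = M_rel_reindex[OF alg \<theta>]
  have "refl_cube S i j \<gamma> \<in> ?M \<and> sym_cube S i \<gamma> \<in> ?M" if \<gamma>: "\<gamma> \<in> ?M" and i: "i \<in> S" for \<gamma> i j
  proof -
    have "(\<lambda>u\<in>Pow S. \<gamma> (insert i u)) \<in> ?M" using i by (intro re[OF _ _ gens(1) \<gamma>]) auto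
    moreover have "(\<lambda>u\<in>Pow S. \<gamma> (u - {i})) \<in> ?M" by (intro re[OF _ _ gens(2) \<gamma>]) auto
    moreover have "(\<lambda>u\<in>Pow S. \<gamma> (if i \<in> u then u - {i} else insert i u)) \<in> ?M"
      using i by (intro re[OF _ _ gens(3) \<gamma>]) auto
    ultimately show ?thesis
      using i by (cases j) (simp_all add: refl_cube_True refl_cube_False sym_cube_eq)
  qed
  then show ?thesis using M_rel_subuniverse[OF alg \<theta>] by (simp add: hd_tolerance_def)
qed

theorem theorem2p6:
  fixes ar :: "'f \<Rightarrow> nat" and A :: "'a set" and F :: "'f \<Rightarrow> 'a list \<Rightarrow> 'a"
    and n :: nat and \<theta> :: "nat \<Rightarrow> 'a rel"
  assumes "algebra ar A F"
    and "in_CM_variety ar A F"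
    and "n \<ge> 2"
    and "\<forall>k<n. \<theta> k \<in> Con ar A F"
  shows "TC_comm ar A F n \<theta> = H_comm ar A F n \<theta>"
proof -
  let ?S = "{..<n}"
  let ?M = "M_rel ar A F ?S \<theta>" and ?D = "Delta_rel ar A F ?S \<theta>"
  have mono: "central ?S \<delta> X" if "central ?S \<delta> Y" "X \<subseteq> Y" for \<delta> :: "'a rel" and X Y
    using that unfolding central_def central_at_def by blast
  \<comment> \<open>Both commutators are intersections of central congruences, so it suffices that
    the two families coincide.\<close>
  have "central ?S \<delta> ?M \<longleftrightarrow> central ?S \<delta> ?D" if \<delta>: "\<delta> \<in> Con ar A F" for \<delta>
  proof
    assume M: "central ?S \<delta> ?M"
    have tol: "hd_tolerance ar A F ?S ?M" using assms by (intro M_rel_tolerance) auto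
    have "?S \<noteq> {k}" for k
    proof
      assume "?S = {k}"
      then have "card ?S = 1" by simp
      then show False using assms(3) by simp
    qed
    then obtain R where "hd_congruence ar A F ?S R" "central ?S \<delta> R" "?M \<subseteq> R"
      using central_congruence_above[OF assms(1,2) \<delta> tol M] by blast
    then show "central ?S \<delta> ?D" unfolding Delta_rel_def by (blast intro: mono)
  next
    assume "central ?S \<delta> ?D"
    then show "central ?S \<delta> ?M" by (rule mono) (auto simp: Delta_rel_def)
  qed
  then show ?thesis unfolding TC_comm_def H_comm_def by (metis (lifting))
qed

end
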